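(* Let $\gamma\subset\mathbb{C}$ be a closed Ahlfors-regular Jordan curve with diameter $d$. Then there is a constant $c>0$ depending only on $\gamma$ such that the following holds. For every continuous function $g:\gamma\to\mathbb{R}$ such that $M_{\gamma}(g,\varepsilon)\to 0$ as $\varepsilon\to 0$, and for each choice of the sign $\pm$, $$\omega_{\overline{D^{\pm}}}\Big(\big({\rm Re}\,\widetilde{g}\big)^{\pm},\varepsilon\Big)\le c\left(M_{\gamma}(g,\varepsilon)+\varepsilon\int_{\varepsilon}^{2d}\frac{\omega_{\gamma}(g,\eta)}{\eta^2}\,d\eta\right)\qquad\text{for all }\varepsilon\in(0,d/8].$$
   Context: Let $\gamma$ be a closed rectifiable Jordan curve in $\mathbb{C}$, oriented counterclockwise, with interior domain $D^+$ and exterior domain $D^-$, and diameter $d:=\max_{t_1,t_2\in\gamma}|t_1-t_2|$. Closures $\overline{D^\pm}$ are taken in $\mathbb{C}$. For $x\in\gamma$ and $\varepsilon>0$ put $\gamma_\varepsilon(x):=\{t\in\gamma:|t-x|\le\varepsilon\}$ and $\theta_x(\varepsilon):=\mathrm{mes}\,\gamma_\varepsilon(x)$, where $\mathrm{mes}$ is the linear Lebesgue (arc length) measure on $\gamma$. The curve $\gamma$ is Ahlfors-regular if $\sup_{x\in\gamma}\theta_x(\varepsilon)=O(\varepsilon)$ as $\varepsilon\to0$. Branch of the argument. For $\xi\in\gamma$ and $0<\delta<d/2$ let $\gamma_{\xi,\delta}$ be the connected component of $\gamma_\delta(\xi)$ containing $\xi$. Choose $\xi_1\in\gamma_{\xi,\delta}$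 at which $\gamma$ has a tangent and which does not precede $\xi$ in the orientation of $\gamma$. Cut the plane along $\gamma[\xi,\xi_1]\cup\Gamma[\xi_1,\infty]$, where $\gamma[\xi,\xi_1]$ is the arc of $\gamma$ from $\xi$ to $\xi_1$ and $\Gamma[\xi_1,\infty]$ is a smooth curve joining $\xi_1$ to $\infty$ that lies in $D^-$ except for its ends. Let $\arg_\delta(z-\xi)$ be the branch of $\mathrm{Arg}(z-\xi)$ continuous off the cut with $\arg_\delta(z_0-\xi)=\phi_0$, where $z_0\in D^+$ and the value $\phi_0$ of $\mathrm{Arg}(z_0-\xi)$ are fixed for all $\delta$. Then $\arg(t-\xi):=\lim_{\delta\to0^+}\arg_\delta(t-\xi)$ for $t\in\gamma\setminus\{\xi\}$; this is a branch continuous on $\gamma\setminus\{\xi\}$. Integrals with respect to $d\arg(t-\xi)$ over subsets of $\gamma$ at positive distance from $\xi$ are Stieltjes integrals along $\gamma$, i.e. $d\arg(t-\xi)={\rm Re}\big(\tfrac{1}{i}\tfrac{dt}{t-\xi}\big)$ there. For continuous $g:\gamma\to\mathbb{R}$ and $\varepsilon>0$ put $$M_{\gamma}(g,\varepsilon):=\sup_{\xi\in\gamma}\,\sup_{\delta\in(0,\varepsilon)}\left|\int_{\gamma_\varepsilon(\xi)\setminus\gamma_\delta(\xi)}\big(g(t)-g(\xi)\big)\,d\arg(t-\xi)\right|.$$ The Cauchy-type integral is $\widetilde g(z):=\frac{1}{2\pi i}\int_\gamma\frac{g(t)}{t-z}\,dt$ for $z\in D^\pm$. It is known that, for Ahlfors-regular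 $\gamma$, the condition $M_\gamma(g,\varepsilon)\to0$ ($\varepsilon\to0$) is necessary and sufficient for ${\rm Re}\,\widetilde g$ to extend continuously to $\gamma$ from $D^+$ and from $D^-$. The continuous extensions of ${\rm Re}\,\widetilde g$ from $D^\pm$ to $\overline{D^\pm}$ are denoted $({\rm Re}\,\widetilde g)^\pm$. For $f:E\to\mathbb{C}$ continuous on $E\subset\mathbb{C}$, the modulus of continuity is $\omega_E(f,\varepsilon):=\sup\{|f(t_1)-f(t_2)|:t_1,t_2\in E,\ |t_1-t_2|\le\varepsilon\}$. *)

theory Defs
  imports "HOL-Complex_Analysis.Complex_Analysis" "HOL-Library.Landau_Symbols"
begin

definition variation_on :: "real set \<Rightarrow> (real \<Rightarrow> 'a::metric_space) \<Rightarrow> ennreal" where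
  "variation_on S f =
     (SUP ts \<in> {ts. sorted ts \<and> set ts \<subseteq> S}.
        \<Sum>i<length ts - 1. ennreal (dist (f (ts ! i)) (f (ts ! Suc i))))"

definition rectifiable_path :: "(real \<Rightarrow> complex) \<Rightarrow> bool" where
  "rectifiable_path p \<longleftrightarrow> path p \<and> variation_on {0..1} p < \<infinity>"

text \<open>The curve is the image of the simple loop \<open>p\<close>; the winding number fixes the
  counterclockwise orientation. Nothing but continuity and finite length is required of the
  parametrization.\<close>

definition rectifiable_jordan_curve :: "(real \<Rightarrow> complex) \<Rightarrow> bool" where
  "rectifiable_jordan_curve p \<longleftrightarrow>
     simple_path p \<and> pathfinish p = pathstart p \<and> rectifiable_path p \<and>
     (\<forall>z \<in> inside (path_image p). winding_number p z = 1)"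

text \<open>The variation of \<open>f\<close> over \<open>[0, t]\<close>, extended by constants outside \<open>[0, 1]\<close>, so that it
  is monotone on the whole line as \<^const>\<open>interval_measure\<close> requires.\<close>

definition variation_fun :: "(real \<Rightarrow> 'a::metric_space) \<Rightarrow> real \<Rightarrow> real" where
  "variation_fun f t = enn2real (variation_on {0..min 1 t} f)"

text \<open>Lebesgue--Stieltjes integral of \<open>h\<close> over \<open>S \<subseteq> [0, 1]\<close> against \<open>df\<close>, for a continuous
  function \<open>f\<close> of bounded variation on \<open>[0, 1]\<close>: on \<open>[0, 1]\<close>, \<open>f\<close> is the difference of the
  continuous nondecreasing functions \<open>V\<close> and \<open>V - f\<close>, with \<open>V\<close> the variation function of \<open>f\<close>.\<close>

definition stieltjes_integral ::
    "real set \<Rightarrow> (real \<Rightarrow> complex) \<Rightarrow> (real \<Rightarrow> real) \<Rightarrow> complex" where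
  "stieltjes_integral S h f =
     (LINT s:S|interval_measure (variation_fun f). h s) -
     (LINT s:S|interval_measure (\<lambda>s. variation_fun f s - f (max 0 (min 1 s))). h s)"

text \<open>The integral of \<open>h(t) dt\<close> over the part of the curve lying in \<open>A\<close>. This need not be a
  finite union of arcs, which is why Lebesgue--Stieltjes integration is used.\<close>

definition curve_integral ::
    "(real \<Rightarrow> complex) \<Rightarrow> complex set \<Rightarrow> (complex \<Rightarrow> complex) \<Rightarrow> complex" where
  "curve_integral p A h =
     stieltjes_integral {s \<in> {0..1}. p s \<in> A} (h \<circ> p) (Re \<circ> p) +
     \<i> * stieltjes_integral {s \<in> {0..1}. p s \<in> A} (h \<circ> p) (Im \<circ> p)"

text \<open>The arc length measure of the part of the curve lying in \<open>A\<close>; the measure on the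
  parameter interval is induced by the arc length function.\<close>

definition arc_length_measure :: "(real \<Rightarrow> complex) \<Rightarrow> complex set \<Rightarrow> real" where
  "arc_length_measure p A =
     measure (interval_measure (variation_fun p)) {s \<in> {0..1}. p s \<in> A}"

definition curve_part :: "(real \<Rightarrow> complex) \<Rightarrow> complex \<Rightarrow> real \<Rightarrow> complex set" where
  "curve_part p x \<epsilon> = {t \<in> path_image p. cmod (t - x) \<le> \<epsilon>}"

definition ahlfors_regular :: "(real \<Rightarrow> complex) \<Rightarrow> bool" where
  "ahlfors_regular p \<longleftrightarrow>
     (\<lambda>\<epsilon>. SUP x \<in> path_image p. arc_length_measure p (curve_part p x \<epsilon>)) \<in> O[at_right 0](\<lambda>\<epsilon>. \<epsilon>)"

text \<open>Suprema are taken in \<^typ>\<open>ennreal\<close>, so that an unbounded family has the value \<open>\<infinity>\<close>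
  rather than an unspecified one.\<close>

definition modulus_of_continuity ::
    "'a::metric_space set \<Rightarrow> ('a \<Rightarrow> 'b::metric_space) \<Rightarrow> real \<Rightarrow> ennreal" where
  "modulus_of_continuity E f \<epsilon> =
     (SUP (t1, t2) \<in> {(t1, t2). t1 \<in> E \<and> t2 \<in> E \<and> dist t1 t2 \<le> \<epsilon>}. ennreal (dist (f t1) (f t2)))"

text \<open>The integral of \<open>h(t) d arg(t - \<xi>)\<close> over the part of the curve lying in \<open>A\<close>, where \<open>A\<close> has
  positive distance from \<open>\<xi>\<close>. There \<open>d arg(t - \<xi>) = Re (1/i dt/(t - \<xi>))\<close>, whichever branch of
  the argument continuous along the curve off \<open>\<xi>\<close> is used; \<open>h\<close> is real, so the real part can be
  taken outside the integral.\<close>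

definition darg_integral ::
    "(real \<Rightarrow> complex) \<Rightarrow> complex \<Rightarrow> complex set \<Rightarrow> (complex \<Rightarrow> real) \<Rightarrow> real" where
  "darg_integral p \<xi> A h =
     Re (1 / \<i> * curve_integral p A (\<lambda>t. of_real (h t) / (t - \<xi>)))"

definition M_curve :: "(real \<Rightarrow> complex) \<Rightarrow> (complex \<Rightarrow> real) \<Rightarrow> real \<Rightarrow> ennreal" where
  "M_curve p g \<epsilon> =
     (SUP \<xi> \<in> path_image p. SUP \<delta> \<in> {0<..<\<epsilon>}.
        ennreal \<bar>darg_integral p \<xi> (curve_part p \<xi> \<epsilon> - curve_part p \<xi> \<delta>) (\<lambda>t. g t - g \<xi>)\<bar>)"

definition cauchy_type_integral ::
    "(real \<Rightarrow> complex) \<Rightarrow> (complex \<Rightarrow> real) \<Rightarrow> complex \<Rightarrow> complex" where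
  "cauchy_type_integral p g z =
     1 / (2 * of_real pi * \<i>) * curve_integral p (path_image p) (\<lambda>t. of_real (g t) / (t - z))"

definition is_continuous_extension ::
    "'a::topological_space set \<Rightarrow> ('a \<Rightarrow> 'b::topological_space) \<Rightarrow> ('a \<Rightarrow> 'b) \<Rightarrow> bool" where
  "is_continuous_extension D f F \<longleftrightarrow>
     continuous_on (closure D) F \<and> (\<forall>z \<in> D. F z = f z)"

end

theory Submission
  imports Defs
begin

text \<open>The real part of the Cauchy-type integral is a double layer potential: for \<open>z\<close> off the curve and
  \<open>\<xi>\<close> on it, \<open>2 \<pi> Re (g~(z)) = 2 \<pi> n g(\<xi>) + \<integral> (g(t) - g(\<xi>)) d arg (t - z)\<close>, where \<open>n\<close> is the winding
  number of the curve about \<open>z\<close>. If \<open>z\<close> lies within a multiple of \<open>\<epsilon>\<close> of \<open>\<xi>\<close> while its distance to the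
  curve is at least a multiple of \<open>\<epsilon>\<close>, the integral differs from the principal value at \<open>\<xi>\<close> by a multiple
  of the right-hand side: the part of the curve within \<open>\<epsilon>\<close> of \<open>\<xi>\<close> is controlled by \<open>M\<close> and Ahlfors
  regularity, the rest by the difference of the kernels, with a Fubini argument that replaces arc
  length by \<open>d\<eta>\<close>. Principal values at nearby points \<open>\<xi>1, \<xi>2\<close> of the curve are compared through a common
  point \<open>w\<close> at distance comparable to \<open>\<epsilon>\<close> from the curve, on whichever side; Ahlfors regularity
  provides \<open>w\<close>. The resulting bound on the oscillation of the boundary values tends to \<open>0\<close> with \<open>\<epsilon>\<close>, so it
  also yields the existence of the continuous extension.\<close>

section \<open>Variation and Lebesgue--Stieltjes measures\<close>

text \<open>The kernel comparison needs \<open>w\<close> no closer to the curve than a multiple of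
  the scale, but points of the domain may be arbitrarily close to it. For those the scale is lowered
  to the distance r from the curve, so both terms of the bound must be controlled at r by their
  values at a larger \<epsilon>. An annulus of outer radius r is a difference of two annuli of outer
  radius \<epsilon>, so M(r) <= 2 M(\<epsilon>). With \<Phi> the integral term, \<Phi>(r) <=
  \<omega>(\<epsilon>) + \<Phi>(\<epsilon>) <= 5 \<Phi>(\<epsilon>). The last step rests on
  \<omega>(r) <= 4 (r / \<epsilon>) \<Phi>(\<epsilon>) for \<epsilon> <= r <= d, which also absorbs
  differences of g. If one of two points at distance \<epsilon> is within 2 \<epsilon> of the curve,
  their nearest boundary points are at most 6 \<epsilon> apart, and \<epsilon> <= d / 8 keeps this
  below d. The parametrization is only continuous, so integrals along the curve are bounded by arc
  length with the factor 8: two coordinates, two monotone parts of each, and a factor 2 for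
  comparing the measures.\<close>

fun var_sum :: "(real \<Rightarrow> 'a::metric_space) \<Rightarrow> real list \<Rightarrow> real" where
  "var_sum f (x # y # zs) = dist (f x) (f y) + var_sum f (y # zs)"
| "var_sum f _ = 0"

lemma var_sum_nonneg: "0 \<le> var_sum f ts"
  by (induction f ts rule: var_sum.induct) auto

lemma var_sum_eq:
  "(\<Sum>i<length ts - 1. ennreal (dist (f (ts ! i)) (f (ts ! Suc i)))) = ennreal (var_sum f ts)"
proof (induction f ts rule: var_sum.induct)
  case (1 f x y zs)
  then show ?case
    by (simp add: sum.lessThan_Suc_shift var_sum_nonneg del: sum.lessThan_Suc)
qed auto

lemma var_sum_append: "var_sum f (xs @ u # ys) = var_sum f (xs @ [u]) + var_sum f (u # ys)"
  by (induction f xs rule: var_sum.induct) (auto simp: var_sum_nonneg)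

lemma var_sum_Cons: "var_sum f ys \<le> var_sum f (u # ys)"
  by (cases ys) auto

lemma var_sum_snoc: "var_sum f xs \<le> var_sum f (xs @ [u])"
  by (induction f xs rule: var_sum.induct) auto

text \<open>Inserting \<open>u\<close> into a partition cannot lower the sum; the triangle
  inequality is needed only for the one step that crosses \<open>u\<close>.\<close>

lemma var_sum_split:
  assumes "sorted ts"
  shows "var_sum f ts \<le> var_sum f (filter (\<lambda>x. x \<le> u) ts @ [u]) + var_sum f (u # filter (\<lambda>x. u < x) ts)"
  using assms
proof (induction f ts rule: var_sum.induct)
  case (1 f x y zs)
  have gt: "filter (\<lambda>x. x \<le> u) (y # zs) = []" "filter (\<lambda>x. u < x) (y # zs) = y # zs" if "u < y"
    using 1(2) that by (auto simp: filter_empty_conv filter_id_conv)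
  consider "x \<le> u" "y \<le> u" | "x \<le> u" "u < y" | "u < x" "u < y"
    using 1(2) by fastforce
  then show ?case
  proof cases
    case 1
    then show ?thesis using "1.IH" "1.prems" by simp
  next
    case 2
    then show ?thesis using gt dist_triangle[of "f x" "f y" "f u"] by simp
  next
    case 3
    then show ?thesis using gt by (simp add: var_sum_nonneg)
  qed
qed (auto simp: var_sum_nonneg)

lemma variation_on_alt:
  "variation_on S f = (SUP ts \<in> {ts. sorted ts \<and> set ts \<subseteq> S}. ennreal (var_sum f ts))"
  unfolding variation_on_def var_sum_eq ..

lemma var_sum_le_variation_on:
  assumes "sorted ts" "set ts \<subseteq> S" shows "ennreal (var_sum f ts) \<le> variation_on S f"
  unfolding variation_on_alt using assms by (auto intro: SUP_upper)

lemma variation_on_mono: "S \<subseteq> T \<Longrightarrow> variation_on S f \<le> variation_on T f"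
  unfolding variation_on_alt by (rule SUP_subset_mono) auto

text \<open>A partition of the long interval is refined by \<open>b\<close>; conversely, partitions
  of the two pieces are joined through \<open>b\<close>.\<close>

lemma variation_on_add:
  assumes "a \<le> b" "b \<le> c"
  shows "variation_on {a..c} f = variation_on {a..b} f + variation_on {b..c} f"
proof (rule antisym)
  show "variation_on {a..c} f \<le> variation_on {a..b} f + variation_on {b..c} f"
    unfolding variation_on_alt[of "{a..c}"]
  proof (rule SUP_least)
    fix ts assume "ts \<in> {ts. sorted ts \<and> set ts \<subseteq> {a..c}}"
    then have ts: "sorted ts" "set ts \<subseteq> {a..c}" by auto
    have "ennreal (var_sum f ts) \<le> ennreal (var_sum f (filter (\<lambda>x. x \<le> b) ts @ [b])) +
        ennreal (var_sum f (b # filter (\<lambda>x. b < x) ts))"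
      using var_sum_split[OF ts(1), of f b] by (simp add: var_sum_nonneg flip: ennreal_plus)
    also have "\<dots> \<le> variation_on {a..b} f + variation_on {b..c} f"
      using ts assms by (intro add_mono var_sum_le_variation_on) (auto simp: sorted_append sorted_wrt_filter)
    finally show "ennreal (var_sum f ts) \<le> variation_on {a..b} f + variation_on {b..c} f" .
  qed
  have *: "ennreal (var_sum f xs) + ennreal (var_sum f ys) \<le> variation_on {a..c} f"
    if "sorted xs" "set xs \<subseteq> {a..b}" "sorted ys" "set ys \<subseteq> {b..c}" for xs ys
  proof -
    have "ennreal (var_sum f xs) + ennreal (var_sum f ys) \<le> ennreal (var_sum f (xs @ b # ys))"
      using var_sum_snoc[of f xs b] var_sum_Cons[of f ys b] var_sum_append[of f xs b ys]
      by (simp add: var_sum_nonneg flip: ennreal_plus)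
    also have "\<dots> \<le> variation_on {a..c} f"
      using that assms by (intro var_sum_le_variation_on) (fastforce simp: sorted_append)+
    finally show ?thesis .
  qed
  have ne: "{ts. sorted ts \<and> set ts \<subseteq> S} \<noteq> {}" for S :: "real set"
    by (auto intro: exI[of _ "[]"])
  have "ennreal (var_sum f xs) + variation_on {b..c} f \<le> variation_on {a..c} f"
    if "sorted xs" "set xs \<subseteq> {a..b}" for xs
    unfolding variation_on_alt[of "{b..c}"]
    by (subst ennreal_SUP_add_right) (use ne * that in \<open>auto intro!: SUP_least\<close>)
  then show "variation_on {a..b} f + variation_on {b..c} f \<le> variation_on {a..c} f"
    unfolding variation_on_alt[of "{a..b}"]
    by (subst ennreal_SUP_add_left[symmetric]) (use ne in \<open>auto intro!: SUP_least\<close>)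
qed

lemma dist_le_variation_on:
  "a \<le> b \<Longrightarrow> ennreal (dist (f a) (f b)) \<le> variation_on {a..b} f"
  using var_sum_le_variation_on[of "[a, b]" "{a..b}" f] by simp

lemma variation_on_contraction:
  assumes "\<And>x y. dist (h x) (h y) \<le> dist x y"
  shows "variation_on S (h \<circ> f) \<le> variation_on S f"
proof -
  have "var_sum (h \<circ> f) ts \<le> var_sum f ts" for ts
    using assms by (induction f ts rule: var_sum.induct) (auto intro: add_mono)
  then show ?thesis unfolding variation_on_alt by (intro SUP_mono') (auto intro: ennreal_leI)
qed

lemma variation_on_singleton: "variation_on {a..a} f = 0"
proof -
  have "var_sum f ts = 0" if "set ts \<subseteq> {a}" for ts
    using that by (induction f ts rule: var_sum.induct) auto
  then show ?thesis unfolding variation_on_alt by (intro SUP_eq_const) (auto intro: exI[of _ "[]"])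
qed

section \<open>The variation function of a continuous path of bounded variation\<close>

definition bv_path :: "(real \<Rightarrow> 'a::metric_space) \<Rightarrow> bool" where
  "bv_path f \<longleftrightarrow> continuous_on {0..1} f \<and> variation_on {0..1} f < \<infinity>"

lemma variation_fun_nonpos: "t \<le> 0 \<Longrightarrow> variation_fun f t = 0"
proof -
  assume "t \<le> 0"
  then have "{0..min 1 t} \<subseteq> {0..0}" by auto
  from variation_on_mono[OF this, of f] show ?thesis
    by (simp add: variation_fun_def variation_on_singleton[of 0, simplified])
qed

lemma variation_fun_clamp: "variation_fun f t = variation_fun f (max 0 (min 1 t))"
proof (cases "t \<le> 0")
  case True then show ?thesis by (simp add: variation_fun_nonpos)
qed (auto simp: variation_fun_def)

lemma variation_fun_diff:
  assumes "bv_path f" "0 \<le> s" "s \<le> t" "t \<le> 1"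
  shows "ennreal (variation_fun f t - variation_fun f s) = variation_on {s..t} f"
    and "variation_fun f s \<le> variation_fun f t"
proof -
  have fin: "variation_on S f < \<infinity>" if "S \<subseteq> {0..1}" for S
    using assms(1) variation_on_mono[OF that, of f] by (auto simp: bv_path_def)
  have e: "variation_fun f s = enn2real (variation_on {0..s} f)" "variation_fun f t = enn2real (variation_on {0..t} f)"
    using assms by (simp_all add: variation_fun_def min_absorb2)
  have f3: "variation_on {0..s} f < \<infinity>" "variation_on {0..t} f < \<infinity>" "variation_on {s..t} f < \<infinity>"
    using assms by (intro fin; auto)+
  have a: "variation_on {0..t} f = variation_on {0..s} f + variation_on {s..t} f"
    using assms by (intro variation_on_add) auto
  have "enn2real (variation_on {0..t} f) = enn2real (variation_on {0..s} f) + enn2real (variation_on {s..t} f)"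
    unfolding a using f3 by (intro enn2real_plus) auto
  then have *: "variation_fun f t = variation_fun f s + enn2real (variation_on {s..t} f)" unfolding e .
  then show "variation_fun f s \<le> variation_fun f t" by simp
  show "ennreal (variation_fun f t - variation_fun f s) = variation_on {s..t} f"
    using * f3 by simp
qed

lemma variation_fun_mono:
  assumes "bv_path f" "s \<le> t" shows "variation_fun f s \<le> variation_fun f t"
  using assms by (subst (1 2) variation_fun_clamp) (intro variation_fun_diff, auto)

lemma dist_le_variation_fun:
  assumes "bv_path f" "s \<le> t"
  shows "dist (f (max 0 (min 1 s))) (f (max 0 (min 1 t))) \<le> variation_fun f t - variation_fun f s"
proof -
  let ?c = "\<lambda>s::real. max 0 (min 1 s)"
  have "ennreal (dist (f (?c s)) (f (?c t))) \<le> variation_on {?c s..?c t} f"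
    using assms by (intro dist_le_variation_on) auto
  also have "\<dots> = ennreal (variation_fun f (?c t) - variation_fun f (?c s))"
    using assms by (subst variation_fun_diff) auto
  also have "\<dots> = ennreal (variation_fun f t - variation_fun f s)"
    by (simp flip: variation_fun_clamp)
  finally show ?thesis using variation_fun_mono[OF assms] by (simp add: ennreal_le_iff)
qed

lemma bv_path_comp:
  assumes "bv_path f" "\<And>x y. dist (h x) (h y) \<le> dist x y"
  shows "bv_path (h \<circ> f)"
proof -
  have "continuous_on UNIV h"
    unfolding continuous_on_iff using assms(2) by (meson le_less_trans)
  then have "continuous_on {0..1} (h \<circ> f)"
    using assms(1) unfolding bv_path_def by (meson continuous_on_compose continuous_on_subset top_greatest)
  then show ?thesis using assms(1) variation_on_contraction[of h "{0..1}" f, OF assms(2)]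
    by (auto simp: bv_path_def)
qed

lemma variation_fun_comp_le:
  assumes "bv_path f" "\<And>x y. dist (h x) (h y) \<le> dist x y" "s \<le> t"
  shows "variation_fun (h \<circ> f) t - variation_fun (h \<circ> f) s \<le> variation_fun f t - variation_fun f s"
proof -
  let ?c = "\<lambda>s::real. max 0 (min 1 s)"
  have "ennreal (variation_fun (h \<circ> f) (?c t) - variation_fun (h \<circ> f) (?c s)) \<le>
    ennreal (variation_fun f (?c t) - variation_fun f (?c s))"
    using assms(3) bv_path_comp[OF assms(1,2)] assms(1)
    by (subst (1 2) variation_fun_diff) (auto intro!: variation_on_contraction assms(2))
  then show ?thesis using variation_fun_mono[OF assms(1,3)]
    by (simp add: ennreal_le_iff flip: variation_fun_clamp)
qed

text \<open>Take a nearly optimal partition of [t, 1] and a point u before its next point after t.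
  Inserting u splits the sum: the part before u is at most |f t - f u|, small by continuity of f,
  and the part after is at most the variation over [u, 1]. Outside [0, 1) the function is constant
  to the right of t.\<close>

lemma variation_fun_right_continuous:
  assumes "bv_path f"
  shows "continuous (at_right t) (variation_fun f)"
proof -
  consider "t < 0" | "1 \<le> t" | "0 \<le> t" "t < 1" by linarith
  then show ?thesis
  proof cases
    case 1
    then have "eventually (\<lambda>x. variation_fun f x = variation_fun f t) (at_right t)"
      unfolding eventually_at_right_field
      by (intro exI[of _ 0]) (auto simp: variation_fun_nonpos)
    then show ?thesis unfolding continuous_within by (rule tendsto_eventually)
  next
    case 2
    then have "eventually (\<lambda>x. variation_fun f x = variation_fun f t) (at_right t)"
      unfolding eventually_at_right_field by (intro exI[of _ "t+1"]) (auto simp: variation_fun_def)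
    then show ?thesis unfolding continuous_within by (rule tendsto_eventually)
  next
    case 3
    have "\<exists>b>t. \<forall>u. t < u \<and> u < b \<longrightarrow> dist (variation_fun f u) (variation_fun f t) < e" if "e > 0" for e
    proof -
      have "variation_on {t..1} f < \<infinity>"
        using assms 3 variation_on_mono[of "{t..1}" "{0..1}" f] by (auto simp: bv_path_def)
      then obtain v where v: "variation_on {t..1} f = ennreal v" "v \<ge> 0"
        by (cases "variation_on {t..1} f") auto
      \<comment> \<open>If \<open>v - e/3\<close> is negative, \<open>ennreal\<close> would truncate
        it to 0; the empty partition serves in that case.\<close>
      have "\<exists>ts. sorted ts \<and> set ts \<subseteq> {t..1} \<and> v - e/3 < var_sum f ts"
      proof (cases "v < e/3")
        case True then show ?thesis by (intro exI[of _ "[]"]) auto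
      next
        case False
        have "ennreal (v - e/3) < variation_on {t..1} f"
          using that False by (simp add: v ennreal_less_iff)
        then show ?thesis unfolding variation_on_alt less_SUP_iff
          using False by (auto simp: ennreal_less_iff)
      qed
      then obtain ts where ts: "sorted ts" "set ts \<subseteq> {t..1}" "v - e/3 < var_sum f ts" by blast
      have "continuous (at t within {0..1}) f"
        using assms 3 by (auto simp: bv_path_def continuous_on_eq_continuous_within)
      then obtain r where r: "r > 0" "\<And>x. x \<in> {0..1} \<Longrightarrow> dist x t < r \<Longrightarrow> dist (f x) (f t) < e/3"
        unfolding continuous_within_eps_delta using \<open>e > 0\<close> by (metis zero_less_divide_iff zero_less_numeral)
      \<comment> \<open>No partition point lies strictly between t and b, and f stays within e/3 of
        f t on [t, b).\<close>
      define b where "b = Min ({1, t + r} \<union> (set ts \<inter> {t<..}))"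
      have "b \<le> x" if "x \<in> {1, t + r} \<union> (set ts \<inter> {t<..})" for x
        unfolding b_def by (rule Min_le) (use that in auto)
      moreover have "b > t" unfolding b_def using 3 r by auto
      ultimately have b: "b > t" "b \<le> 1" "b \<le> t + r" "\<And>x. x \<in> set ts \<Longrightarrow> x > t \<Longrightarrow> b \<le> x"
        by auto
      have "dist (variation_fun f u) (variation_fun f t) < e" if u: "t < u" "u < b" for u
      proof -
        have "filter (\<lambda>x. x \<le> u) ts = filter (\<lambda>x. x = t) ts"
          using b(4) u ts(2) by (intro filter_cong) force+
        \<comment> \<open>Partitions are lists and may repeat t; the repetitions contribute
          nothing.\<close>
        have rep: "var_sum f (replicate n t @ [u]) \<le> dist (f t) (f u)" for n
        proof (induction n)
          case (Suc n) then show ?case by (cases n) auto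
        qed auto
        have "filter (\<lambda>x. x = t) ts = replicate (length (filter (\<lambda>x. x = t) ts)) t"
          by (rule replicate_length_same[symmetric]) auto
        then have "var_sum f (filter (\<lambda>x. x = t) ts @ [u]) \<le> dist (f t) (f u)"
          by (metis rep)
        also have "\<dots> < e/3" using r(2)[of u] u b 3 by (subst dist_commute) (simp add: dist_real_def)
        finally have A: "var_sum f (filter (\<lambda>x. x \<le> u) ts @ [u]) < e/3"
          using \<open>filter (\<lambda>x. x \<le> u) ts = filter (\<lambda>x. x = t) ts\<close> by simp
        have "ennreal (var_sum f (u # filter (\<lambda>x. u < x) ts)) \<le> variation_on {u..1} f"
          using ts u b by (intro var_sum_le_variation_on) (auto simp: sorted_wrt_filter)
        also have "\<dots> = ennreal (variation_fun f 1 - variation_fun f u)"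
          using u b 3 assms by (subst variation_fun_diff) auto
        finally have B: "var_sum f (u # filter (\<lambda>x. u < x) ts) \<le> variation_fun f 1 - variation_fun f u"
          using variation_fun_mono[OF assms, of u 1] u b by (simp add: ennreal_le_iff)
        have "ennreal v = ennreal (variation_fun f 1 - variation_fun f t)"
          using assms 3 by (subst variation_fun_diff) (auto simp: v)
        then have "v = variation_fun f 1 - variation_fun f t"
          using v(2) variation_fun_mono[OF assms, of t 1] 3 by simp
        then have "variation_fun f u - variation_fun f t < e"
          using A B ts(3) var_sum_split[OF ts(1), of f u] \<open>e > 0\<close> by simp
        then show ?thesis using variation_fun_mono[OF assms, of t u] u by (simp add: dist_real_def)
      qed
      then show ?thesis using b(1) by blast
    qed
    then show ?thesis
      unfolding continuous_within tendsto_iff eventually_at_right_field by blast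
  qed
qed

text \<open>\<open>interval_measure F\<close> is only meaningful when \<open>F\<close> is nondecreasing and right-continuous;
  boundedness makes the measure finite.\<close>

definition distribution_like :: "(real \<Rightarrow> real) \<Rightarrow> bool" where
  "distribution_like F \<longleftrightarrow> mono F \<and> (\<forall>a. continuous (at_right a) F) \<and> bounded (range F)"

lemma distribution_like_add: "distribution_like F \<Longrightarrow> distribution_like G \<Longrightarrow> distribution_like (\<lambda>x. F x + G x)"
  unfolding distribution_like_def by (auto simp: mono_def add_mono bounded_plus_comp intro!: continuous_add)

lemma emeasure_Ioc:
  assumes "distribution_like F" "a \<le> b"
  shows "emeasure (interval_measure F) {a<..b} = ennreal (F b - F a)"
  using assms by (intro emeasure_interval_measure_Ioc) (auto simp: distribution_like_def mono_def)

lemma UN_Ioc_eq_UNIV: "(\<Union>n. {- real n<..real n}) = UNIV"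
proof -
  have "x \<in> {- real (nat \<lceil>\<bar>x\<bar>\<rceil> + 1)<..real (nat \<lceil>\<bar>x\<bar>\<rceil> + 1)}" for x by (auto; linarith)
  then show ?thesis by blast
qed

lemma finite_interval_measure:
  assumes "distribution_like F" shows "finite_measure (interval_measure F)"
proof
  obtain B where B: "\<And>x. \<bar>F x\<bar> \<le> B" using assms by (auto simp: distribution_like_def bounded_iff)
  have "(SUP n. emeasure (interval_measure F) {- real n<..real n}) = emeasure (interval_measure F) (\<Union>n. {- real n<..real n})"
    by (rule SUP_emeasure_incseq) (auto simp: incseq_def)
  also note UN_Ioc_eq_UNIV
  finally have "emeasure (interval_measure F) UNIV = (SUP n. emeasure (interval_measure F) {- real n<..real n})" ..
  also have "\<dots> \<le> ennreal (2 * B)"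
  proof (rule SUP_least)
    fix n :: nat
    have "F (real n) - F (- real n) \<le> 2 * B" using B[of "real n"] B[of "- real n"] by linarith
    then show "emeasure (interval_measure F) {- real n<..real n} \<le> ennreal (2 * B)"
      by (subst emeasure_Ioc[OF assms]) (auto intro: ennreal_leI)
  qed
  finally show "emeasure (interval_measure F) (space (interval_measure F)) \<noteq> \<infinity>"
    by (auto simp: top_unique)
qed

text \<open>A Dynkin argument: both sides agree on half-open intervals, a generator of the Borel
  sets that is stable under intersection. Finiteness of the measures makes the complement step a
  subtraction.\<close>

lemma measure_interval_measure_add:
  assumes F: "distribution_like F" and G: "distribution_like G" and A: "A \<in> sets borel"
  shows "measure (interval_measure (\<lambda>x. F x + G x)) A = measure (interval_measure F) A + measure (interval_measure G) A"
proof -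
  let ?H = "\<lambda>x. F x + G x"
  have H: "distribution_like ?H" by (rule distribution_like_add[OF F G])
  interpret f: finite_measure "interval_measure F" by (rule finite_interval_measure[OF F])
  interpret g: finite_measure "interval_measure G" by (rule finite_interval_measure[OF G])
  interpret h: finite_measure "interval_measure ?H" by (rule finite_interval_measure[OF H])
  let ?G = "range (\<lambda>(a, b). {a<..b::real})"
  let ?P = "\<lambda>A. measure (interval_measure ?H) A = measure (interval_measure F) A + measure (interval_measure G) A"
  have basic: "?P {a<..b}" for a b
  proof (cases "a \<le> b")
    case True
    then have "F a \<le> F b" "G a \<le> G b" using F G by (auto simp: distribution_like_def mono_def)
    then show ?thesis using True F G H by (simp add: measure_def emeasure_Ioc enn2real_ennreal)
  qed auto
  have sb: "sets borel = sigma_sets UNIV ?G"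
    using borel_sigma_sets_Ioc by (metis sets_measure_of top_greatest subset_UNIV Pow_UNIV)
  \<comment> \<open>The whole line is not in the generator, but complements are taken in it.\<close>
  have U: "?P UNIV"
  proof -
    have L1: "(\<lambda>n. measure (interval_measure ?H) {- real n<..real n}) \<longlonglongrightarrow> measure (interval_measure ?H) (\<Union>n. {- real n<..real n})"
      by (rule h.finite_Lim_measure_incseq) (auto simp: incseq_def)
    have L2: "(\<lambda>n. measure (interval_measure F) {- real n<..real n}) \<longlonglongrightarrow> measure (interval_measure F) (\<Union>n. {- real n<..real n})"
      by (rule f.finite_Lim_measure_incseq) (auto simp: incseq_def)
    have L3: "(\<lambda>n. measure (interval_measure G) {- real n<..real n}) \<longlonglongrightarrow> measure (interval_measure G) (\<Union>n. {- real n<..real n})"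
      by (rule g.finite_Lim_measure_incseq) (auto simp: incseq_def)
    show ?thesis using LIMSEQ_unique[OF L1[unfolded basic] tendsto_add[OF L2 L3]] unfolding UN_Ioc_eq_UNIV .
  qed
  have "A \<in> sigma_sets UNIV ?G" using A sb by simp
  moreover have "Int_stable ?G" by (auto simp: Int_stable_def)
  moreover have "?G \<subseteq> Pow UNIV" by auto
  ultimately have "A \<in> sigma_sets UNIV ?G" "Int_stable ?G" "?G \<subseteq> Pow UNIV" by blast+
  from this(2,3,1) show ?thesis
  proof (induction rule: sigma_sets_induct_disjoint)
    case (basic A) then show ?case using \<open>\<And>a b. ?P {a<..b}\<close> by auto
  next
    case empty show ?case by simp
  next
    case (compl A)
    have "A \<in> sets borel" using compl(1) sb by simp
    then have "A \<in> sets (interval_measure F)" "A \<in> sets (interval_measure G)" "A \<in> sets (interval_measure ?H)" by auto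
    then show ?case using f.finite_measure_compl[of A] g.finite_measure_compl[of A] h.finite_measure_compl[of A] U compl(2) by simp
  next
    case (union A)
    have r: "range A \<subseteq> sets borel" using union(2) sb by simp
    have L1: "(\<lambda>i. measure (interval_measure ?H) (A i)) sums measure (interval_measure ?H) (\<Union>i. A i)"
      using r union(1) by (intro h.finite_measure_UNION) auto
    have L2: "(\<lambda>i. measure (interval_measure F) (A i)) sums measure (interval_measure F) (\<Union>i. A i)"
      using r union(1) by (intro f.finite_measure_UNION) auto
    have L3: "(\<lambda>i. measure (interval_measure G) (A i)) sums measure (interval_measure G) (\<Union>i. A i)"
      using r union(1) by (intro g.finite_measure_UNION) auto
    show ?case by (rule sums_unique2[OF L1[unfolded union(3)] sums_add[OF L2 L3]])
  qed
qed

text \<open>2 G is the sum of F and 2 G - F, and the latter is again a distribution function by the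
  monotonicity assumption; additivity of the measures then bounds the measure of F by twice that of
  G.\<close>

lemma nn_integral_interval_measure_dominated:
  assumes F: "distribution_like F" and G: "distribution_like G" and m: "mono (\<lambda>x. 2 * G x - F x)"
    and h[measurable]: "h \<in> borel_measurable borel"
  shows "(\<integral>\<^sup>+x. h x \<partial>interval_measure F) \<le> 2 * (\<integral>\<^sup>+x. h x \<partial>interval_measure G)"
proof -
  have D: "distribution_like (\<lambda>x. 2 * G x - F x)"
    using F G m unfolding distribution_like_def
    by (auto intro!: continuous_intros bounded_minus_comp
        bounded_plus_comp[of G UNIV G, folded mult_2])
  have *: "measure (interval_measure F) A \<le> 2 * measure (interval_measure G) A" if "A \<in> sets borel" for A
  proof -
    have "measure (interval_measure G) A + measure (interval_measure G) A = measure (interval_measure (\<lambda>x. G x + G x)) A"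
      using measure_interval_measure_add[OF G G that] by simp
    also have "(\<lambda>x. G x + G x) = (\<lambda>x. F x + (2 * G x - F x))" by auto
    also have "measure (interval_measure \<dots>) A = measure (interval_measure F) A + measure (interval_measure (\<lambda>x. 2 * G x - F x)) A"
      using measure_interval_measure_add[OF F D that] by simp
    finally show ?thesis using measure_nonneg[of "interval_measure (\<lambda>x. 2 * G x - F x)" A] by linarith
  qed
  interpret f: finite_measure "interval_measure F" by (rule finite_interval_measure[OF F])
  interpret g: finite_measure "interval_measure G" by (rule finite_interval_measure[OF G])
  let ?N = "scale_measure 2 (interval_measure G)"
  have "interval_measure F \<le> ?N"
  proof -
    have "emeasure (interval_measure F) A \<le> emeasure ?N A" for A
    proof (cases "A \<in> sets borel")
      case True
      then show ?thesis using *[OF True]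
        by (simp add: f.emeasure_eq_measure g.emeasure_eq_measure ennreal_mult'[symmetric]
             flip: ennreal_numeral)
    qed (simp add: emeasure_notin_sets)
    then show ?thesis by (simp add: le_measure_iff le_fun_def space_scale_measure)
  qed
  then have "(\<integral>\<^sup>+x. h x \<partial>interval_measure F) \<le> (\<integral>\<^sup>+x. h x \<partial>?N)"
    by (intro nn_integral_mono_measure) auto
  then show ?thesis by (simp add: nn_integral_scale_measure)
qed

section \<open>Integration along a rectifiable curve\<close>

lemma distribution_like_variation_fun:
  assumes "bv_path f" shows "distribution_like (variation_fun f)"
  unfolding distribution_like_def
proof (intro conjI allI)
  show "mono (variation_fun f)" using variation_fun_mono[OF assms] by (simp add: mono_def)
  show "continuous (at_right a) (variation_fun f)" for a by (rule variation_fun_right_continuous[OF assms])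
  have "variation_fun f x \<in> {0..variation_fun f 1}" for x
    using variation_fun_mono[OF assms, of 0 "max 0 (min 1 x)"] variation_fun_mono[OF assms, of "max 0 (min 1 x)" 1]
    by (simp add: variation_fun_nonpos flip: variation_fun_clamp)
  then show "bounded (range (variation_fun f))"
    by (intro bounded_subset[OF bounded_closed_interval[of 0 "variation_fun f 1"]]) auto
qed

text \<open>Increments of \<open>f\<close> never exceed those of its variation. This is the second
  measure in \<open>stieltjes_integral\<close>.\<close>

lemma distribution_like_variation_fun_minus:
  fixes f :: "real \<Rightarrow> real"
  assumes "bv_path f" shows "distribution_like (\<lambda>s. variation_fun f s - f (max 0 (min 1 s)))"
  unfolding distribution_like_def
proof (intro conjI allI)
  show "mono (\<lambda>s. variation_fun f s - f (max 0 (min 1 s)))"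
    using dist_le_variation_fun[OF assms] by (force simp: mono_def dist_real_def abs_le_iff)
  have c: "continuous_on UNIV (\<lambda>s. f (max 0 (min 1 s)))"
    by (rule continuous_on_compose2[of "{0..1}" f]) (use assms in \<open>auto simp: bv_path_def intro!: continuous_intros\<close>)
  show "continuous (at_right a) (\<lambda>s. variation_fun f s - f (max 0 (min 1 s)))" for a
    by (rule continuous_diff[OF variation_fun_right_continuous[OF assms]])
       (use c in \<open>auto simp: continuous_on_eq_continuous_within intro: continuous_within_subset\<close>)
  have "bounded (f ` {0..1})"
    by (intro compact_imp_bounded compact_continuous_image) (use assms in \<open>auto simp: bv_path_def\<close>)
  then have "bounded (range (\<lambda>s. f (max 0 (min 1 s))))"
    by (rule bounded_subset) auto
  then show "bounded (range (\<lambda>s. variation_fun f s - f (max 0 (min 1 s))))"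
    using distribution_like_variation_fun[OF assms] by (auto simp: distribution_like_def intro: bounded_minus_comp)
qed

text \<open>All measures that occur are finite, so boundedness gives integrability. Only the values
  on \<open>S\<close> are constrained, which allows kernels with a pole outside
  \<open>S\<close>.\<close>

definition admissible :: "real set \<Rightarrow> (real \<Rightarrow> complex) \<Rightarrow> bool" where
  "admissible S h \<longleftrightarrow> S \<in> sets borel \<and> S \<subseteq> {0..1} \<and> set_borel_measurable borel S h \<and> bounded (h ` S)"

lemma admissible_set_integrable:
  assumes "admissible S h" "distribution_like F"
  shows "set_integrable (interval_measure F) S h"
proof -
  interpret finite_measure "interval_measure F" by (rule finite_interval_measure[OF assms(2)])
  obtain B where B: "\<And>s. s \<in> S \<Longrightarrow> cmod (h s) \<le> B" using assms(1) by (auto simp: admissible_def bounded_iff)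
  show ?thesis unfolding set_integrable_def
  proof (rule integrable_const_bound[where B = "max B 0"])
    show "AE x in interval_measure F. norm (indicat_real S x *\<^sub>R h x) \<le> max B 0"
      by (intro AE_I2) (use B in \<open>force simp: indicator_def le_max_iff_disj\<close>)
    show "(\<lambda>x. indicat_real S x *\<^sub>R h x) \<in> borel_measurable (interval_measure F)"
      using assms(1) by (auto simp: admissible_def set_borel_measurable_def)
  qed
qed

lemma admissible_diff:
  "admissible S h \<Longrightarrow> admissible S k \<Longrightarrow> admissible S (\<lambda>s. h s - k s)"
  unfolding admissible_def set_borel_measurable_def
  by (auto simp: scaleR_diff_right intro: bounded_minus_comp)

lemma admissible_mult:
  assumes "admissible S h" "admissible S k" shows "admissible S (\<lambda>s. h s * k s)"
proof -
  have prod: "(\<lambda>s. indicat_real S s *\<^sub>R (h s * k s)) = (\<lambda>s. (indicat_real S s *\<^sub>R h s) * (indicat_real S s *\<^sub>R k s))"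
    by (auto simp: indicator_def)
  obtain B where "\<And>s. s \<in> S \<Longrightarrow> cmod (h s) \<le> B"
    using assms(1) by (auto simp: admissible_def bounded_iff)
  moreover obtain C where "\<And>s. s \<in> S \<Longrightarrow> cmod (k s) \<le> C"
    using assms(2) by (auto simp: admissible_def bounded_iff)
  ultimately have "\<And>s. s \<in> S \<Longrightarrow> cmod (h s * k s) \<le> B * C"
    unfolding norm_mult by (metis mult_mono norm_ge_zero order.trans)
  then have "bounded ((\<lambda>s. h s * k s) ` S)" by (auto simp: bounded_iff)
  moreover have "set_borel_measurable borel S (\<lambda>s. h s * k s)"
    using assms unfolding admissible_def set_borel_measurable_def prod
    by (intro borel_measurable_times) auto
  ultimately show ?thesis using assms unfolding admissible_def by auto
qed

lemma admissible_subset: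
  assumes "admissible S h" "T \<subseteq> S" "T \<in> sets borel" shows "admissible T h"
proof -
  have "(\<lambda>s. indicat_real T s *\<^sub>R h s) = (\<lambda>s. indicat_real T s *\<^sub>R (indicat_real S s *\<^sub>R h s))"
    using assms(2) by (intro ext) (auto simp: indicator_def)
  then show ?thesis using assms
    unfolding admissible_def set_borel_measurable_def
    by (auto intro: bounded_subset simp del: scaleR_scaleR intro!: borel_measurable_scaleR borel_measurable_indicator)
qed

lemma admissible_continuous:
  assumes "continuous_on {0..1} h" "S \<in> sets borel" "S \<subseteq> {0..1}" shows "admissible S h"
proof -
  have "admissible {0..1} h"
    unfolding admissible_def set_borel_measurable_def
    using borel_measurable_continuous_on_indicator[OF _ assms(1)] compact_imp_bounded[OF compact_continuous_image[OF assms(1)]]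
    by auto
  then show ?thesis using assms by (rule_tac admissible_subset)
qed

lemma admissible_const: "S \<in> sets borel \<Longrightarrow> S \<subseteq> {0..1} \<Longrightarrow> admissible S (\<lambda>_. c)"
  by (rule admissible_continuous) auto

lemma admissible_cong: "(\<And>s. s \<in> S \<Longrightarrow> h s = k s) \<Longrightarrow> admissible S h = admissible S k"
proof -
  assume *: "\<And>s. s \<in> S \<Longrightarrow> h s = k s"
  then have "(\<lambda>s. indicat_real S s *\<^sub>R h s) = (\<lambda>s. indicat_real S s *\<^sub>R k s)"
    by (intro ext) (auto simp: indicator_def)
  moreover have "h ` S = k ` S" using * by auto
  ultimately show ?thesis unfolding admissible_def set_borel_measurable_def by simp
qed

text \<open>A curve integral indexed by parameters instead of points, so that it can be cut into
  half-open parameter intervals.\<close>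

definition parameter_integral :: "(real \<Rightarrow> complex) \<Rightarrow> real set \<Rightarrow> (real \<Rightarrow> complex) \<Rightarrow> complex" where
  "parameter_integral p S h = stieltjes_integral S h (Re \<circ> p) + \<i> * stieltjes_integral S h (Im \<circ> p)"

lemma curve_integral_eq:
  "curve_integral p A h = parameter_integral p {s \<in> {0..1}. p s \<in> A} (h \<circ> p)"
  by (simp add: curve_integral_def parameter_integral_def)

lemma stieltjes_integral_cong:
  "(\<And>s. s \<in> S \<Longrightarrow> h s = k s) \<Longrightarrow> S \<in> sets borel \<Longrightarrow> stieltjes_integral S h f = stieltjes_integral S k f"
  unfolding stieltjes_integral_def set_lebesgue_integral_def
  by (intro arg_cong2[where f = minus] Bochner_Integration.integral_cong) (auto simp: indicator_def)

lemma parameter_integral_cong: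
  "(\<And>s. s \<in> S \<Longrightarrow> h s = k s) \<Longrightarrow> S \<in> sets borel \<Longrightarrow> parameter_integral p S h = parameter_integral p S k"
  unfolding parameter_integral_def using stieltjes_integral_cong by metis

context
  fixes f :: "real \<Rightarrow> real"
  assumes bv: "bv_path f"
begin

lemma stieltjes_integral_diff:
  assumes "admissible S h" "admissible S k"
  shows "stieltjes_integral S (\<lambda>s. h s - k s) f = stieltjes_integral S h f - stieltjes_integral S k f"
  unfolding stieltjes_integral_def
  by (simp add: set_integral_diff(2) admissible_set_integrable assms
      distribution_like_variation_fun[OF bv] distribution_like_variation_fun_minus[OF bv])

lemma stieltjes_integral_cmult:
  "stieltjes_integral S (\<lambda>s. c * h s) f = c * stieltjes_integral S h f"
  unfolding stieltjes_integral_def by (simp add: algebra_simps)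

lemma stieltjes_integral_Un:
  assumes "admissible S h" "admissible T h" "S \<inter> T = {}"
  shows "stieltjes_integral (S \<union> T) h f = stieltjes_integral S h f + stieltjes_integral T h f"
  unfolding stieltjes_integral_def
  by (simp add: set_integral_Un admissible_set_integrable assms
      distribution_like_variation_fun[OF bv] distribution_like_variation_fun_minus[OF bv])

text \<open>The increments of the variation cancel between the two measures and leave the increment
  of \<open>f\<close>.\<close>

lemma stieltjes_integral_Ioc:
  assumes "0 \<le> a" "a \<le> b" "b \<le> 1"
  shows "stieltjes_integral {a<..b} (\<lambda>_. c) f = c * of_real (f b - f a)"
proof -
  have "(LINT s:{a<..b}|interval_measure F. c) = of_real (F b - F a) * c" if "distribution_like F" for F
  proof -
    interpret finite_measure "interval_measure F" by (rule finite_interval_measure[OF that])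
    have "measure (interval_measure F) {a<..b} = F b - F a"
      using emeasure_Ioc[OF that assms(2)] that assms(2)
      by (auto simp: measure_def distribution_like_def mono_def)
    then show ?thesis by (simp add: set_lebesgue_integral_def scaleR_conv_of_real)
  qed
  note * = this[OF distribution_like_variation_fun[OF bv]] this[OF distribution_like_variation_fun_minus[OF bv]]
  show ?thesis unfolding stieltjes_integral_def *
    using assms by (simp add: max_absorb2 min_absorb2 algebra_simps)
qed

end

section \<open>Integrals along a rectifiable curve and their bound by arc length\<close>

locale rectifiable_curve =
  fixes p :: "real \<Rightarrow> complex"
  assumes rectifiable: "rectifiable_path p"
begin

abbreviation arc_measure :: "real measure" where
  "arc_measure \<equiv> interval_measure (variation_fun p)"

lemma bv: "bv_path p"
  using rectifiable by (simp add: bv_path_def rectifiable_path_def path_def)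

lemma bv_Re: "bv_path (Re \<circ> p)"
  by (rule bv_path_comp[OF bv]) (metis abs_Re_le_cmod dist_norm dist_real_def minus_complex.simps(1))

lemma bv_Im: "bv_path (Im \<circ> p)"
  by (rule bv_path_comp[OF bv]) (metis abs_Im_le_cmod dist_norm dist_real_def minus_complex.simps(2))

lemma distr: "distribution_like (variation_fun p)"
  by (rule distribution_like_variation_fun[OF bv])

sublocale finite_measure arc_measure
  by (rule finite_interval_measure[OF distr])

lemma continuous_p: "continuous_on {0..1} p"
  using bv by (simp add: bv_path_def)

text \<open>For \<open>Re\<close> and \<open>Im\<close> as \<phi>. Each of the two measures is at
  most twice arc length, so the constant is 2 + 2.\<close>

lemma stieltjes_integral_bound:
  assumes "\<And>x y. dist (\<phi> x) (\<phi> y) \<le> dist x y" and S: "admissible S h"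
  shows "ennreal (cmod (stieltjes_integral S h (\<phi> \<circ> p))) \<le> 4 * (\<integral>\<^sup>+s\<in>S. ennreal (cmod (h s)) \<partial>arc_measure)"
proof -
  define f where "f = \<phi> \<circ> p"
  have bf: "bv_path f" unfolding f_def by (rule bv_path_comp[OF bv assms(1)])
  have inc: "variation_fun f t - variation_fun f s \<le> variation_fun p t - variation_fun p s" if "s \<le> t" for s t
    unfolding f_def by (rule variation_fun_comp_le[OF bv assms(1) that])
  have *: "ennreal (cmod (LINT s:S|interval_measure F. h s)) \<le> 2 * (\<integral>\<^sup>+s\<in>S. ennreal (cmod (h s)) \<partial>arc_measure)"
    if F: "distribution_like F" and m: "mono (\<lambda>x. 2 * variation_fun p x - F x)" for F
  proof -
    have hm[measurable]: "(\<lambda>s. indicat_real S s *\<^sub>R h s) \<in> borel_measurable borel"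
      using S by (simp add: admissible_def set_borel_measurable_def)
    have "ennreal (cmod (LINT s:S|interval_measure F. h s)) \<le> (\<integral>\<^sup>+s. ennreal (norm (indicat_real S s *\<^sub>R h s)) \<partial>interval_measure F)"
      unfolding set_lebesgue_integral_def using admissible_set_integrable[OF S F]
      by (intro integral_norm_bound_ennreal) (simp add: set_integrable_def)
    also have "\<dots> \<le> 2 * (\<integral>\<^sup>+s. ennreal (norm (indicat_real S s *\<^sub>R h s)) \<partial>arc_measure)"
      by (rule nn_integral_interval_measure_dominated[OF F distr m]) measurable
    also have "(\<integral>\<^sup>+s. ennreal (norm (indicat_real S s *\<^sub>R h s)) \<partial>arc_measure) = (\<integral>\<^sup>+s\<in>S. ennreal (cmod (h s)) \<partial>arc_measure)"
      by (intro nn_integral_cong) (auto simp: indicator_def)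
    finally show ?thesis .
  qed
  let ?I = "\<integral>\<^sup>+s\<in>S. ennreal (cmod (h s)) \<partial>arc_measure"
  have i1: "ennreal (cmod (LINT s:S|interval_measure (variation_fun f). h s)) \<le> 2 * ?I"
  proof (rule *[OF distribution_like_variation_fun[OF bf]], rule monoI)
    fix x y :: real assume "x \<le> y"
    then show "2 * variation_fun p x - variation_fun f x \<le> 2 * variation_fun p y - variation_fun f y"
      using inc[of x y] variation_fun_mono[OF bf, of x y] by linarith
  qed
  \<comment> \<open>An increment of V - f is at most twice that of V, hence at most twice the arc
    length; the factor 2 comes from here.\<close>
  have i2: "ennreal (cmod (LINT s:S|interval_measure (\<lambda>s. variation_fun f s - f (max 0 (min 1 s))). h s)) \<le> 2 * ?I"
  proof (rule *[OF distribution_like_variation_fun_minus[OF bf]], rule monoI)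
    fix x y :: real assume "x \<le> y"
    then show "2 * variation_fun p x - (variation_fun f x - f (max 0 (min 1 x))) \<le> 2 * variation_fun p y - (variation_fun f y - f (max 0 (min 1 y)))"
      using inc[of x y] dist_le_variation_fun[OF bf, of x y] by (auto simp: dist_real_def abs_if split: if_splits)
  qed
  have "ennreal (cmod (stieltjes_integral S h f)) \<le>
     ennreal (cmod (LINT s:S|interval_measure (variation_fun f). h s)) +
     ennreal (cmod (LINT s:S|interval_measure (\<lambda>s. variation_fun f s - f (max 0 (min 1 s))). h s))"
    unfolding stieltjes_integral_def
    by (simp add: norm_triangle_ineq4 flip: ennreal_plus)
  also have "\<dots> \<le> 2 * ?I + 2 * ?I" by (rule add_mono[OF i1 i2])
  also have "\<dots> = 4 * ?I" by (simp flip: distrib_right)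
  finally show ?thesis by (simp add: f_def)
qed

text \<open>The real and the imaginary coordinate contribute 4 each.\<close>

lemma parameter_integral_bound:
  assumes "admissible S h"
  shows "ennreal (cmod (parameter_integral p S h)) \<le> 8 * (\<integral>\<^sup>+s\<in>S. ennreal (cmod (h s)) \<partial>arc_measure)"
proof -
  let ?I = "\<integral>\<^sup>+s\<in>S. ennreal (cmod (h s)) \<partial>arc_measure"
  have "ennreal (cmod (parameter_integral p S h)) \<le>
     ennreal (cmod (stieltjes_integral S h (Re \<circ> p))) + ennreal (cmod (stieltjes_integral S h (Im \<circ> p)))"
    using norm_triangle_ineq[of "stieltjes_integral S h (Re \<circ> p)" "\<i> * stieltjes_integral S h (Im \<circ> p)"]
    by (simp add: parameter_integral_def norm_mult flip: ennreal_plus)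
  also have "\<dots> \<le> 4 * ?I + 4 * ?I"
    by (intro add_mono stieltjes_integral_bound assms)
       (metis abs_Re_le_cmod abs_Im_le_cmod dist_norm dist_real_def minus_complex.simps)+
  also have "\<dots> = 8 * ?I" by (simp flip: distrib_right)
  finally show ?thesis .
qed

lemma parameter_integral_diff:
  assumes "admissible S h" "admissible S k"
  shows "parameter_integral p S (\<lambda>s. h s - k s) = parameter_integral p S h - parameter_integral p S k"
  unfolding parameter_integral_def
  by (simp add: stieltjes_integral_diff[OF bv_Re assms] stieltjes_integral_diff[OF bv_Im assms] algebra_simps)

lemma parameter_integral_cmult:
  "parameter_integral p S (\<lambda>s. c * h s) = c * parameter_integral p S h"
  unfolding parameter_integral_def
  by (simp add: stieltjes_integral_cmult[OF bv_Re] stieltjes_integral_cmult[OF bv_Im] algebra_simps)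

lemma parameter_integral_Un:
  assumes "admissible S h" "admissible T h" "S \<inter> T = {}"
  shows "parameter_integral p (S \<union> T) h = parameter_integral p S h + parameter_integral p T h"
  unfolding parameter_integral_def
  by (simp add: stieltjes_integral_Un[OF bv_Re assms] stieltjes_integral_Un[OF bv_Im assms] algebra_simps)

lemma parameter_integral_Ioc:
  assumes "0 \<le> a" "a \<le> b" "b \<le> 1"
  shows "parameter_integral p {a<..b} (\<lambda>_. c) = c * (p b - p a)"
proof -
  have "parameter_integral p {a<..b} (\<lambda>_. c) = c * (of_real (Re (p b - p a)) + \<i> * of_real (Im (p b - p a)))"
    unfolding parameter_integral_def
    by (simp add: stieltjes_integral_Ioc[OF bv_Re assms] stieltjes_integral_Ioc[OF bv_Im assms] algebra_simps)
  then show ?thesis by (metis complex_eq)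
qed

lemma emeasure_arc_Ioc: "a \<le> b \<Longrightarrow> emeasure arc_measure {a<..b} = ennreal (variation_fun p b - variation_fun p a)"
  by (rule emeasure_Ioc[OF distr])

lemma emeasure_arc_0: "emeasure arc_measure {0} = 0"
proof -
  have "emeasure arc_measure {0} \<le> emeasure arc_measure {-1<..0}"
    by (rule emeasure_mono) auto
  then show ?thesis by (simp add: emeasure_arc_Ioc variation_fun_nonpos)
qed

text \<open>Half-open cells tile \<open>{0<..1}\<close> and miss the parameter 0, which carries no
  mass because \<open>variation_fun\<close> vanishes up to 0.\<close>

lemma parameter_integral_drop_0:
  assumes "admissible {0..1} h"
  shows "parameter_integral p {0..1} h = parameter_integral p {0<..1} h"
proof -
  have 0: "admissible {0} h" "admissible {0<..1} h"
    by (auto intro!: admissible_subset[OF assms])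
  have "{0..1} = {0} \<union> {0<..1::real}" by auto
  then have "parameter_integral p {0..1} h = parameter_integral p {0} h + parameter_integral p {0<..1} h"
    using parameter_integral_Un[OF 0] by simp
  moreover have "(\<integral>\<^sup>+s\<in>{0}. ennreal (cmod (h s)) \<partial>arc_measure) = 0"
    using emeasure_arc_0 by (intro nn_integral_null_set) (auto simp: null_sets_def)
  then have "parameter_integral p {0} h = 0"
    using parameter_integral_bound[OF 0(1)] by (simp only: mult_zero_right le_zero_eq ennreal_eq_0_iff norm_le_zero_iff)
  ultimately show ?thesis by simp
qed

end

section \<open>The winding number as a curve integral\<close>

lemma norm_exp_minus_1_minus_le:
  fixes z :: complex
  assumes "cmod z \<le> 1/2" shows "cmod (exp z - 1 - z) \<le> 2 * (cmod z)\<^sup>2"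
proof -
  have "cmod (exp z - 1 - z) \<le> exp \<bar>Re z\<bar> * (cmod z)\<^sup>2"
    using Taylor_exp[of z 1] by (simp add: power2_eq_square diff_diff_eq)
  also have "exp \<bar>Re z\<bar> \<le> 2"
    using exp_half_le2 abs_Re_le_cmod[of z] assms by (meson exp_le_cancel_iff order.trans)
  finally show ?thesis by (simp add: mult_right_mono)
qed

context rectifiable_curve
begin

lemma parameter_integral_partition:
  assumes "admissible {0<..1} h" "N > 0" "n \<le> N"
  shows "parameter_integral p {0<..real n / real N} h =
    (\<Sum>i<n. parameter_integral p {real i / real N<..real (Suc i) / real N} h)"
  using assms(3)
proof (induction n)
  case 0
  have "parameter_integral p {0<..0} h = parameter_integral p {0<..0} (\<lambda>_. 0)"
    by (rule parameter_integral_cong) auto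
  then show ?case using parameter_integral_Ioc[of 0 0 0] by simp
next
  case (Suc n)
  let ?a = "real n / real N" and ?b = "real (Suc n) / real N"
  have ab: "0 \<le> ?a" "?a \<le> ?b" "?b \<le> 1" using Suc.prems assms(2) by (auto simp: field_simps)
  have interval: "{0<..a} \<subseteq> {0<..1}" "{a<..b} \<subseteq> {0<..1}" if "0 \<le> a" "a \<le> b" "b \<le> 1" for a b :: real
    using that by auto
  have "{0<..?b} = {0<..?a} \<union> {?a<..?b}" by (rule ivl_disj_un_two(6)[OF ab(1,2), symmetric])
  moreover have "{0<..?a} \<inter> {?a<..?b} = {}" by auto
  moreover have "admissible {0<..?a} h" "admissible {?a<..?b} h"
    by (rule admissible_subset[OF assms(1) interval(1)[OF ab]] admissible_subset[OF assms(1) interval(2)[OF ab]]; simp)+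
  ultimately have "parameter_integral p {0<..?b} h = parameter_integral p {0<..?a} h + parameter_integral p {?a<..?b} h"
    using parameter_integral_Un by metis
  then show ?case using Suc by simp
qed

text \<open>Riemann sums for \<open>dp / (p - z)\<close> are compared with the increments of a continuous logarithm.\<close>

lemma parameter_integral_winding:
  assumes z: "z \<notin> path_image p"
  shows "parameter_integral p {0..1} (\<lambda>s. 1 / (p s - z)) = 2 * of_real pi * \<i> * winding_number p z"
proof -
  have path: "path p" using continuous_p by (simp add: path_def)
  obtain q where q: "path q" "pathfinish q - pathstart q = 2 * of_real pi * \<i> * winding_number p z"
      "\<And>t. t \<in> {0..1} \<Longrightarrow> p t = z + exp (q t)"
    using winding_number_as_continuous_log[OF path z] by blast
  define k where "k = (\<lambda>s. 1 / (p s - z))"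
  have nz: "p s \<noteq> z" if "s \<in> {0..1}" for s using q(3)[OF that] by auto
  have contk: "continuous_on {0..1} k" unfolding k_def
    by (intro continuous_intros continuous_p) (use nz in auto)
  obtain B where B: "B > 0" "\<And>s. s \<in> {0..1} \<Longrightarrow> cmod (k s) \<le> B"
    using compact_imp_bounded[OF compact_continuous_image[OF contk]] by (auto simp: bounded_pos)
  define V where "V = variation_fun p"
  have Vm: "V s \<le> V t" if "s \<le> t" for s t unfolding V_def by (rule variation_fun_mono[OF bv that])
  have V0: "V 0 = 0" "V 1 \<ge> 0" using Vm[of 0 1] by (auto simp: V_def variation_fun_nonpos)
  have adm: "admissible {0..1} k" "admissible {0<..1} k"
    by (rule admissible_continuous[OF contk]; auto)+
  \<comment> \<open>The bound is linear in \<eta>, so letting \<eta> tend to 0 yields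
    equality.\<close>
  have close: "cmod (parameter_integral p {0<..1} k - (q 1 - q 0)) \<le> (8 + 8 * B) * V 1 * \<eta>"
    if \<eta>: "0 < \<eta>" "\<eta> \<le> 1/4" for \<eta>
  proof -
    have "uniformly_continuous_on {0..1} q" "uniformly_continuous_on {0..1} k"
      using q(1) contk by (auto intro!: compact_uniformly_continuous simp: path_def)
    then obtain d1 d2 where d: "d1 > 0" "d2 > 0"
        "\<And>x y. x \<in> {0..1} \<Longrightarrow> y \<in> {0..1} \<Longrightarrow> dist y x < d1 \<Longrightarrow> dist (q y) (q x) < \<eta>"
        "\<And>x y. x \<in> {0..1} \<Longrightarrow> y \<in> {0..1} \<Longrightarrow> dist y x < d2 \<Longrightarrow> dist (k y) (k x) < \<eta>"
      unfolding uniformly_continuous_on_def using \<eta>(1) by metis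
    obtain N where N: "N > 0" "1 / real N < min d1 d2"
      using d(1,2) by (metis nat_approx_posE min_less_iff_conj zero_less_Suc)
    \<comment> \<open>On a short cell the integral is close to k(a) (p(b) - p(a)), which is exactly
      exp \<Delta> - 1 for the increment \<Delta> of the logarithm, and this is \<Delta> up to
      second order.\<close>
    have piece: "cmod (parameter_integral p {a<..b} k - (q b - q a)) \<le> (8 + 8 * B) * \<eta> * (V b - V a)"
      if ab: "0 \<le> a" "a \<le> b" "b \<le> 1" "b - a < d1" "b - a < d2" for a b
    proof -
      define \<Delta> where "\<Delta> = q b - q a"
      have "dist (q b) (q a) < \<eta>" using ab by (intro d(3)) (auto simp: dist_real_def)
      then have D: "cmod \<Delta> < \<eta>" by (simp add: \<Delta>_def dist_norm)
      have ad: "admissible {a<..b} k" "admissible {a<..b} (\<lambda>_. k a)"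
        using ab by (auto intro!: admissible_continuous[OF contk] admissible_const)
      have e: "k a * (p b - p a) = exp \<Delta> - 1"
        using q(3)[of a] q(3)[of b] ab by (simp add: k_def \<Delta>_def exp_diff field_simps)
      have "ennreal (cmod (parameter_integral p {a<..b} (\<lambda>s. k s - k a))) \<le>
          8 * (\<integral>\<^sup>+s\<in>{a<..b}. ennreal (cmod (k s - k a)) \<partial>arc_measure)"
        by (intro parameter_integral_bound admissible_diff ad)
      also have "\<dots> \<le> 8 * (\<integral>\<^sup>+s\<in>{a<..b}. ennreal \<eta> \<partial>arc_measure)"
      proof (intro mult_left_mono nn_integral_mono)
        fix s show "ennreal (cmod (k s - k a)) * indicator {a<..b} s \<le> ennreal \<eta> * indicator {a<..b} s"
          using d(4)[of a s] ab by (auto simp: indicator_def dist_real_def dist_norm intro!: ennreal_leI)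
      qed auto
      also have "\<dots> = ennreal (8 * (\<eta> * (V b - V a)))"
        using ab \<eta> Vm[of a b] emeasure_arc_Ioc[of a b]
        by (simp add: nn_integral_cmult_indicator ennreal_mult V_def)
      finally have "cmod (parameter_integral p {a<..b} (\<lambda>s. k s - k a)) \<le> 8 * (\<eta> * (V b - V a))"
        using ab \<eta> Vm[of a b] by (subst (asm) ennreal_le_iff) auto
      then have 1: "cmod (parameter_integral p {a<..b} k - (exp \<Delta> - 1)) \<le> 8 * (\<eta> * (V b - V a))"
        using parameter_integral_diff[OF ad] parameter_integral_Ioc[OF ab(1-3), of "k a"] e by simp
      have t: "cmod (exp \<Delta> - 1 - \<Delta>) \<le> 2 * (cmod \<Delta>)\<^sup>2"
        by (rule norm_exp_minus_1_minus_le) (use D \<eta> in linarith)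
      have sq: "2 * (cmod \<Delta>)\<^sup>2 \<le> 2 * \<eta> * cmod \<Delta>"
        using D by (simp add: power2_eq_square mult_right_mono)
      \<comment> \<open>To sum the quadratic errors, |\<Delta>| must be bounded by the arc length of
        the cell, but \<open>q\<close> comes only with continuity. So |\<Delta>| is bounded by 2
        |exp \<Delta> - 1|, where \<eta> <= 1/4 enters, and exp \<Delta> - 1 by the increment of
        \<open>p\<close>.\<close>
      have half: "2 * \<eta> * cmod \<Delta> \<le> cmod \<Delta> / 2" using \<eta> mult_right_mono[of \<eta> "1/4" "cmod \<Delta>"] by simp
      have "cmod \<Delta> / 2 \<le> cmod (exp \<Delta> - 1)"
        using norm_triangle_ineq2[of \<Delta> "exp \<Delta> - 1"] t sq half by (simp add: norm_minus_commute)
      also have "\<dots> = cmod (k a) * cmod (p b - p a)" by (simp add: e[symmetric] norm_mult)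
      also have "\<dots> \<le> B * (V b - V a)"
        using B ab dist_le_variation_fun[OF bv ab(2)] Vm[of a b]
        by (intro mult_mono) (auto simp: V_def dist_norm norm_minus_commute max_absorb2 min_absorb2)
      finally have h: "cmod \<Delta> \<le> 2 * (B * (V b - V a))" by simp
      have "2 * \<eta> * cmod \<Delta> \<le> 2 * \<eta> * (2 * (B * (V b - V a)))" using h \<eta> by (intro mult_left_mono) auto
      then have 2: "cmod (exp \<Delta> - 1 - \<Delta>) \<le> 4 * B * \<eta> * (V b - V a)" using t sq by (simp add: algebra_simps)
      have "cmod (parameter_integral p {a<..b} k - \<Delta>) \<le> 8 * (\<eta> * (V b - V a)) + 4 * B * \<eta> * (V b - V a)"
        using norm_triangle_ineq[of "parameter_integral p {a<..b} k - (exp \<Delta> - 1)" "exp \<Delta> - 1 - \<Delta>"] 1 2 by simp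
      also have "\<dots> \<le> (8 + 8 * B) * \<eta> * (V b - V a)"
      proof -
        have "0 \<le> B * (\<eta> * (V b - V a))" using B \<eta> ab Vm[of a b] by simp
        then show ?thesis by (simp add: algebra_simps)
      qed
      finally show ?thesis by (simp add: \<Delta>_def)
    qed
    define x where "x = (\<lambda>i. real i / real N)"
    have x: "0 \<le> x i" "x i \<le> x (Suc i)" "x (Suc i) \<le> 1" "x (Suc i) - x i < d1" "x (Suc i) - x i < d2" if "i < N" for i
      using that N by (auto simp: x_def field_simps)
    have xN: "x N = 1" "x 0 = 0" using N by (auto simp: x_def)
    have telq: "(\<Sum>i<N. q (x (Suc i)) - q (x i)) = q 1 - q 0"
      using sum_lessThan_telescope[of "\<lambda>i. q (x i)" N] xN by simp
    have telV: "(\<Sum>i<N. V (x (Suc i)) - V (x i)) = V 1 - V 0"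
      using sum_lessThan_telescope[of "\<lambda>i. V (x i)" N] xN by simp
    have "parameter_integral p {0<..1} k = (\<Sum>i<N. parameter_integral p {x i<..x (Suc i)} k)"
      using parameter_integral_partition[OF adm(2) N(1), of N] N unfolding x_def by simp
    then have "parameter_integral p {0<..1} k - (q 1 - q 0) =
       (\<Sum>i<N. parameter_integral p {x i<..x (Suc i)} k - (q (x (Suc i)) - q (x i)))"
      unfolding telq[symmetric] by (simp only: sum_subtractf)
    also have "cmod \<dots> \<le> (\<Sum>i<N. (8 + 8 * B) * \<eta> * (V (x (Suc i)) - V (x i)))"
      by (intro sum_norm_le piece x) auto
    also have "\<dots> = (8 + 8 * B) * V 1 * \<eta>"
      using telV V0 by (simp add: sum_distrib_left[symmetric])
    finally show ?thesis .
  qed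
  have "parameter_integral p {0<..1} k = q 1 - q 0"
  proof (rule ccontr)
    assume "parameter_integral p {0<..1} k \<noteq> q 1 - q 0"
    then have pos: "0 < cmod (parameter_integral p {0<..1} k - (q 1 - q 0))" (is "0 < ?x") by simp
    define C where "C = (8 + 8 * B) * V 1"
    have C: "C \<ge> 0" using B V0 by (simp add: C_def)
    define \<eta> where "\<eta> = min (1/4) (?x / (2 * (C + 1)))"
    have "0 < \<eta>" "\<eta> \<le> 1/4"
      using pos C unfolding \<eta>_def by (simp, intro min.cobounded1)
    from close[OF this] have "?x \<le> C * \<eta>" by (simp add: C_def)
    also have "\<dots> \<le> C * (?x / (2 * (C + 1)))" using C by (intro mult_left_mono) (auto simp: \<eta>_def)
    also have "\<dots> < ?x"
    proof -
      have "C * ?x < (2 * (C + 1)) * ?x" using C pos by (intro mult_strict_right_mono) auto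
      then show ?thesis using C by (simp add: pos_divide_less_eq mult.commute)
    qed
    finally show False by simp
  qed
  then show ?thesis
    using parameter_integral_drop_0[OF adm(1)] q(2) by (simp add: k_def pathfinish_def pathstart_def)
qed

end

section \<open>Ahlfors-regular curves\<close>

text \<open>The witness is the least parameter where u = r, attained since that set is closed; a
  larger value before it would produce an earlier one by the intermediate value theorem.\<close>

lemma first_exit:
  fixes u :: "real \<Rightarrow> real"
  assumes "continuous_on {a..b} u" "a \<le> b" "u a \<le> r" "r \<le> u b"
  obtains c where "c \<in> {a..b}" "u c = r" "\<And>s. s \<in> {a..c} \<Longrightarrow> u s \<le> r"
proof -
  define T where "T = {s \<in> {a..b}. u s = r}"
  have "T \<noteq> {}" using IVT'[of u a r b] assms by (auto simp: T_def)
  moreover have "closed T" unfolding T_def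
    using continuous_closed_preimage[OF assms(1), of "{r}"] by (simp add: vimage_def Int_def conj_commute)
  moreover have "bdd_below T" by (auto simp: T_def intro: bdd_belowI[of _ a])
  ultimately have c: "Inf T \<in> T" "\<And>s. s \<in> T \<Longrightarrow> Inf T \<le> s"
    by (auto intro: closed_contains_Inf cInf_lower)
  have "u s \<le> r" if s: "s \<in> {a..Inf T}" for s
  proof (rule ccontr)
    assume "\<not> u s \<le> r"
    moreover have "s \<le> b" using s c(1) by (auto simp: T_def)
    moreover have "continuous_on {a..s} u" using assms(1) by (rule continuous_on_subset) (use \<open>s \<le> b\<close> in auto)
    ultimately obtain x where "a \<le> x" "x \<le> s" "u x = r"
      using IVT'[of u a r s] assms(3) s by auto
    then have "x \<in> T" "x \<noteq> s" using \<open>s \<le> b\<close> \<open>\<not> u s \<le> r\<close> by (auto simp: T_def)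
    then show False using c(2)[of x] s \<open>x \<le> s\<close> by auto
  qed
  then show thesis using c(1) by (intro that[of "Inf T"]) (auto simp: T_def)
qed

text \<open>Reversal of the parameter in \<open>first_exit\<close>.\<close>

lemma last_entry:
  fixes u :: "real \<Rightarrow> real"
  assumes "continuous_on {a..b} u" "a \<le> b" "u b \<le> r" "r \<le> u a"
  obtains c where "c \<in> {a..b}" "u c = r" "\<And>s. s \<in> {c..b} \<Longrightarrow> u s \<le> r"
proof -
  have "continuous_on {-b..-a} (\<lambda>s. u (- s))"
    by (rule continuous_on_compose2[OF assms(1)]) (auto intro!: continuous_intros)
  then obtain c where c: "c \<in> {-b..-a}" "u (-c) = r" "\<And>s. s \<in> {-b..c} \<Longrightarrow> u (-s) \<le> r"
    by (rule first_exit) (use assms in auto)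
  have "u s \<le> r" if "s \<in> {-c..b}" for s using c(3)[of "-s"] that by simp
  then show thesis using c by (intro that[of "-c"]) auto
qed

text \<open>The length bound is assumed at every radius, not only asymptotically, so that K alone
  determines all later constants.\<close>

locale ahlfors_curve = rectifiable_curve +
  fixes K :: real
  assumes K_pos: "0 < K"
    and ahlfors: "\<And>x \<epsilon>. x \<in> path_image p \<Longrightarrow> 0 < \<epsilon> \<Longrightarrow>
      emeasure arc_measure {s \<in> {0..1}. cmod (p s - x) \<le> \<epsilon>} \<le> ennreal (K * \<epsilon>)"
begin

text \<open>A continuous, hence Borel, function on the whole line; \<open>p\<close> itself is
  arbitrary outside [0, 1].\<close>

definition clamped where "clamped s = p (max 0 (min 1 s))"

lemma clamped_eq: "s \<in> {0..1} \<Longrightarrow> clamped s = p s"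
  by (simp add: clamped_def)

lemma clamped_continuous: "continuous_on UNIV clamped"
  unfolding clamped_def by (rule continuous_on_compose2[OF continuous_p]) (auto intro!: continuous_intros)

lemma clamped_measurable[measurable]: "clamped \<in> borel_measurable borel"
  by (rule borel_measurable_continuous_onI[OF clamped_continuous])

lemma bounded_image: "bounded (path_image p)" and closed_image: "closed (path_image p)"
  using compact_continuous_image[OF continuous_p] by (auto simp: path_image_def compact_imp_bounded compact_imp_closed)

lemma p_in_image: "s \<in> {0..1} \<Longrightarrow> p s \<in> path_image p"
  by (simp add: path_image_def)

lemma sets_dist[measurable]:
  "{s \<in> {0..1}. cmod (p s - x) \<le> r} \<in> sets borel" "{s \<in> {0..1}. r < cmod (p s - x)} \<in> sets borel"
proof -
  have "{s \<in> {0..1}. cmod (p s - x) \<le> r} = {s \<in> {0..1}. cmod (clamped s - x) \<le> r}"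
    "{s \<in> {0..1}. r < cmod (p s - x)} = {s \<in> {0..1}. r < cmod (clamped s - x)}" by (auto simp: clamped_eq)
  then show "{s \<in> {0..1}. cmod (p s - x) \<le> r} \<in> sets borel" "{s \<in> {0..1}. r < cmod (p s - x)} \<in> sets borel"
    by simp_all
qed

text \<open>Starting at x, the curve has to leave the disc of radius r, because r is below half the
  diameter. The arc up to the circle stays in the disc and has a chord of length r.\<close>

lemma arc_measure_ge:
  assumes x: "x \<in> path_image p" and r: "0 < r" "r < diameter (path_image p) / 2"
  shows "ennreal r \<le> emeasure arc_measure {s \<in> {0..1}. cmod (p s - x) \<le> r}"
proof -
  obtain s0 where s0: "s0 \<in> {0..1}" "p s0 = x" using x by (auto simp: path_image_def)
  have "\<exists>y\<in>path_image p. r < cmod (y - x)"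
  proof (rule ccontr)
    assume "\<not> ?thesis"
    then have "cmod (y - x) \<le> r" if "y \<in> path_image p" for y using that by force
    then have "dist y z \<le> 2 * r" if "y \<in> path_image p" "z \<in> path_image p" for y z
      using that dist_triangle2[of y z x] by (simp add: dist_norm) (smt (verit))
    then have "diameter (path_image p) \<le> 2 * r" using r x by (intro diameter_le) (auto simp: dist_norm)
    then show False using r by simp
  qed
  then obtain s1 where s1: "s1 \<in> {0..1}" "r < cmod (p s1 - x)" by (auto simp: path_image_def)
  have cont: "continuous_on {a..b} (\<lambda>s. cmod (p s - x))" if "0 \<le> a" "b \<le> 1" for a b
    by (intro continuous_intros continuous_on_subset[OF continuous_p]) (use that in auto)
  have "\<exists>a b. 0 \<le> a \<and> a \<le> b \<and> b \<le> 1 \<and> cmod (p b - p a) = r \<and> (\<forall>s\<in>{a..b}. cmod (p s - x) \<le> r)"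
  proof (cases "s0 \<le> s1")
    case True
    obtain c where "c \<in> {s0..s1}" "cmod (p c - x) = r" "\<And>s. s \<in> {s0..c} \<Longrightarrow> cmod (p s - x) \<le> r"
      by (rule first_exit[OF cont True, of r]) (use s0 s1 r in auto)
    then show ?thesis using s0 s1 by (intro exI[of _ s0] exI[of _ c]) auto
  next
    case False
    then have le: "s1 \<le> s0" by simp
    obtain c where "c \<in> {s1..s0}" "cmod (p c - x) = r" "\<And>s. s \<in> {c..s0} \<Longrightarrow> cmod (p s - x) \<le> r"
      by (rule last_entry[OF cont le, of r]) (use s0 s1 r in auto)
    then show ?thesis using s0 s1 by (intro exI[of _ c] exI[of _ s0]) (auto simp: norm_minus_commute)
  qed
  then obtain a b where ab: "0 \<le> a" "a \<le> b" "b \<le> 1" "cmod (p b - p a) = r" "\<forall>s\<in>{a..b}. cmod (p s - x) \<le> r"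
    by blast
  have "r \<le> variation_fun p b - variation_fun p a"
    using dist_le_variation_fun[OF bv ab(2)] ab by (simp add: dist_norm norm_minus_commute max_absorb2 min_absorb2)
  then have "ennreal r \<le> emeasure arc_measure {a<..b}"
    using ab by (simp add: emeasure_arc_Ioc ennreal_leI)
  also have "\<dots> \<le> emeasure arc_measure {s \<in> {0..1}. cmod (p s - x) \<le> r}"
    using ab(1-3,5) by (intro emeasure_mono) (auto simp del: atLeastAtMost_iff, auto)
  finally show ?thesis .
qed

text \<open>If every point of a disc of radius \<open>\<epsilon>\<close> were within \<open>c \<epsilon>\<close> of the curve, the double integral of
  \<open>[|t - w| \<le> 2 c \<epsilon>]\<close> over \<open>t\<close> on the curve and \<open>w\<close> in the disc would be at least of order
  \<open>c \<epsilon>\<^sup>3\<close>, but integrating over \<open>w\<close> first shows that it is at most of order \<open>c\<^sup>2 \<epsilon>\<^sup>3\<close>.\<close>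

lemma porosity:
  defines "c \<equiv> min (1/4) (1 / (16 * K))"
  assumes x: "x \<in> path_image p" and \<epsilon>: "0 < \<epsilon>" "\<epsilon> < diameter (path_image p)"
  shows "\<exists>w. cmod (w - x) \<le> \<epsilon> \<and> (\<forall>t\<in>path_image p. c * \<epsilon> \<le> cmod (t - w))"
proof (rule ccontr)
  assume "\<not> ?thesis"
  then have neg: "\<exists>t\<in>path_image p. cmod (t - w) < c * \<epsilon>" if "cmod (w - x) \<le> \<epsilon>" for w
    using that by (meson not_le)
  have c: "0 < c" "c \<le> 1/4" "c \<le> 1 / (16 * K)" using K_pos by (auto simp: c_def)
  define \<kappa> :: real where "\<kappa> = unit_ball_vol 2"
  have \<kappa>: "\<kappa> > 0" unfolding \<kappa>_def by simp
  define F :: "real \<Rightarrow> complex \<Rightarrow> ennreal" where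
    "F = (\<lambda>s w. indicator {0..1} s * indicator {w. cmod (clamped s - w) \<le> 2 * c * \<epsilon>} w * indicator {w. cmod (w - x) < \<epsilon>} w)"
  have "case_prod F \<in> borel_measurable (borel \<Otimes>\<^sub>M borel)"
    unfolding F_def by measurable
  moreover have "sets (arc_measure \<Otimes>\<^sub>M (lborel :: complex measure)) = sets (borel \<Otimes>\<^sub>M borel)"
    by (intro sets_pair_measure_cong) auto
  ultimately have F: "case_prod F \<in> borel_measurable (arc_measure \<Otimes>\<^sub>M lborel)"
    by (simp cong: measurable_cong_sets)
  interpret pair_sigma_finite arc_measure "lborel :: complex measure" ..
  \<comment> \<open>A curve point t within c \<epsilon> of w exists by assumption, and the disc of
    radius c \<epsilon> about t lies in the one of radius 2 c \<epsilon> about w.\<close>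
  have low: "ennreal (c * \<epsilon>) * indicator (ball x \<epsilon>) w \<le> (\<integral>\<^sup>+s. F s w \<partial>arc_measure)" for w
  proof (cases "w \<in> ball x \<epsilon>")
    case True
    then obtain t where t: "t \<in> path_image p" "cmod (t - w) < c * \<epsilon>"
      using neg[of w] by (auto simp: dist_norm norm_minus_commute less_imp_le)
    have "c * \<epsilon> \<le> 1/4 * \<epsilon>" using c \<epsilon> by (intro mult_right_mono) auto
    then have "c * \<epsilon> < diameter (path_image p) / 2" using \<epsilon> by linarith
    then have "ennreal (c * \<epsilon>) \<le> emeasure arc_measure {s \<in> {0..1}. cmod (p s - t) \<le> c * \<epsilon>}"
      using c(1) \<epsilon> by (intro arc_measure_ge t) auto
    also have "\<dots> = (\<integral>\<^sup>+s. indicator {s \<in> {0..1}. cmod (p s - t) \<le> c * \<epsilon>} s \<partial>arc_measure)"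
      by (rule nn_integral_indicator[symmetric]) (simp only: sets_interval_measure sets_dist)
    also have "\<dots> \<le> (\<integral>\<^sup>+s. F s w \<partial>arc_measure)"
    proof (intro nn_integral_mono)
      fix s
      have "cmod (p s - w) \<le> 2 * c * \<epsilon>" if "cmod (p s - t) \<le> c * \<epsilon>"
        using that t(2) norm_triangle_ineq[of "p s - t" "t - w"] by simp
      then show "indicator {s \<in> {0..1}. cmod (p s - t) \<le> c * \<epsilon>} s \<le> F s w"
        using True by (auto simp: F_def indicator_def clamped_eq dist_norm norm_minus_commute)
    qed
    finally show ?thesis using True by simp
  qed auto
  \<comment> \<open>As c <= 1/4, curve points that see some w of the disc lie within 2 \<epsilon> of
    x; for each of them the set of such w has area at most \<kappa> (2 c \<epsilon>)^2.\<close>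
  have up: "(\<integral>\<^sup>+w. F s w \<partial>lborel) \<le> ennreal (\<kappa> * (2 * c * \<epsilon>)\<^sup>2) * indicator {s \<in> {0..1}. cmod (p s - x) \<le> 2 * \<epsilon>} s" for s
  proof (cases "s \<in> {0..1} \<and> cmod (p s - x) \<le> 2 * \<epsilon>")
    case True
    have "(\<integral>\<^sup>+w. F s w \<partial>lborel) \<le> (\<integral>\<^sup>+w. indicator (cball (p s) (2 * c * \<epsilon>)) w \<partial>lborel)"
      using True by (intro nn_integral_mono) (auto simp: F_def indicator_def clamped_eq dist_norm)
    also have "\<dots> = ennreal (\<kappa> * (2 * c * \<epsilon>)\<^sup>2)"
      using c \<epsilon> by (simp add: emeasure_cball \<kappa>_def)
    finally show ?thesis using True by simp
  next
    case False
    have "F s w = 0" for w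
    proof (rule ccontr)
      assume "F s w \<noteq> 0"
      then have *: "s \<in> {0..1}" "cmod (p s - w) \<le> 2 * c * \<epsilon>" "cmod (w - x) < \<epsilon>"
        by (auto simp: F_def clamped_eq dist_norm norm_minus_commute indicator_def split: if_splits)
      have "2 * c * \<epsilon> \<le> \<epsilon>" using c \<epsilon> by (simp add: mult_le_cancel_right1)
      then show False using * False norm_triangle_ineq[of "p s - w" "w - x"] by auto
    qed
    then show ?thesis by simp
  qed
  have "ennreal (c * \<epsilon>) * ennreal (\<kappa> * \<epsilon>\<^sup>2) = (\<integral>\<^sup>+w. ennreal (c * \<epsilon>) * indicator (ball x \<epsilon>) w \<partial>lborel)"
    using \<epsilon> by (simp add: nn_integral_cmult_indicator emeasure_ball \<kappa>_def)
  also have "\<dots> \<le> (\<integral>\<^sup>+w. \<integral>\<^sup>+s. F s w \<partial>arc_measure \<partial>lborel)" by (intro nn_integral_mono low)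
  also have "\<dots> = (\<integral>\<^sup>+s. \<integral>\<^sup>+w. F s w \<partial>lborel \<partial>arc_measure)" by (rule Fubini'[OF F])
  also have "\<dots> \<le> (\<integral>\<^sup>+s. ennreal (\<kappa> * (2 * c * \<epsilon>)\<^sup>2) * indicator {s \<in> {0..1}. cmod (p s - x) \<le> 2 * \<epsilon>} s \<partial>arc_measure)"
    by (intro nn_integral_mono up)
  also have "\<dots> = ennreal (\<kappa> * (2 * c * \<epsilon>)\<^sup>2) * emeasure arc_measure {s \<in> {0..1}. cmod (p s - x) \<le> 2 * \<epsilon>}"
    by (intro nn_integral_cmult_indicator) (simp only: sets_interval_measure sets_dist)
  also have "\<dots> \<le> ennreal (\<kappa> * (2 * c * \<epsilon>)\<^sup>2) * ennreal (K * (2 * \<epsilon>))"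
    using x \<epsilon> by (intro mult_left_mono ahlfors) auto
  finally have "c * \<epsilon> * (\<kappa> * \<epsilon>\<^sup>2) \<le> \<kappa> * (2 * c * \<epsilon>)\<^sup>2 * (K * (2 * \<epsilon>))"
    using c \<epsilon> \<kappa> K_pos by (simp add: ennreal_le_iff flip: ennreal_mult')
  \<comment> \<open>Cancelling the common factor leaves 1 <= 8 K c, which contradicts c <= 1 / (16
    K).\<close>
  then have "c * (\<kappa> * \<epsilon> ^ 3) * 1 \<le> c * (\<kappa> * \<epsilon> ^ 3) * (8 * K * c)" by (simp add: power2_eq_square power3_eq_cube algebra_simps)
  moreover have "0 < c * (\<kappa> * \<epsilon> ^ 3)" using c \<kappa> \<epsilon> by simp
  ultimately have "1 \<le> 8 * K * c" by (simp only: mult_le_cancel_left_pos)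
  moreover have "8 * K * c \<le> 1/2" using mult_left_mono[OF c(3), of "8 * K"] K_pos by (simp add: field_simps)
  ultimately show False by simp
qed

text \<open>As \<open>\<omega>\<close> is monotone, \<open>\<omega>(r) / r\<^sup>2\<close> is at most \<open>4 / r\<close> times the integral of \<open>\<omega>(\<eta>) / \<eta>\<^sup>2\<close> over
  \<open>[r, 2 r]\<close>, which is where the upper limit \<open>2 d\<close> comes from; the order of integration is then
  exchanged. A dyadic decomposition would not do, since \<open>\<omega>\<close> need not be doubling on a curve.\<close>

lemma far_integral:
  fixes \<omega> :: "real \<Rightarrow> real"
  assumes \<omega>: "mono \<omega>" "\<And>\<eta>. 0 \<le> \<omega> \<eta>" and x: "x \<in> path_image p" and \<epsilon>: "0 < \<epsilon>"
  defines "d \<equiv> diameter (path_image p)"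
  shows "(\<integral>\<^sup>+s\<in>{s \<in> {0..1}. \<epsilon> < cmod (p s - x)}. ennreal (\<omega> (cmod (p s - x)) / (cmod (p s - x))\<^sup>2) \<partial>arc_measure)
    \<le> ennreal (8 * K) * (\<integral>\<^sup>+\<eta>\<in>{\<epsilon>..2 * d}. ennreal (\<omega> \<eta> / \<eta>\<^sup>2) \<partial>lborel)"
proof -
  have [measurable]: "\<omega> \<in> borel_measurable borel" by (rule borel_measurable_mono[OF \<omega>(1)])
  define \<sigma> where "\<sigma> s = cmod (clamped s - x)" for s
  have [measurable]: "\<sigma> \<in> borel_measurable borel" unfolding \<sigma>_def by measurable
  define F :: "real \<Rightarrow> real \<Rightarrow> ennreal" where
    "F = (\<lambda>s \<eta>. if 0 \<le> s \<and> s \<le> 1 \<and> \<epsilon> < \<sigma> s \<and> \<sigma> s \<le> \<eta> \<and> \<eta> \<le> 2 * \<sigma> s \<and> \<epsilon> \<le> \<eta> \<and> \<eta> \<le> 2 * d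
       then ennreal (4 / \<sigma> s * (\<omega> \<eta> / \<eta>\<^sup>2)) else 0)"
  have "case_prod F \<in> borel_measurable (borel \<Otimes>\<^sub>M borel)"
    unfolding F_def by measurable
  moreover have "sets (arc_measure \<Otimes>\<^sub>M (lborel :: real measure)) = sets (borel \<Otimes>\<^sub>M borel)"
    by (intro sets_pair_measure_cong) auto
  ultimately have F: "case_prod F \<in> borel_measurable (arc_measure \<Otimes>\<^sub>M lborel)"
    by (simp cong: measurable_cong_sets)
  interpret pair_sigma_finite arc_measure "lborel :: real measure" ..
  have low: "ennreal (\<omega> (cmod (p s - x)) / (cmod (p s - x))\<^sup>2) * indicator {s \<in> {0..1}. \<epsilon> < cmod (p s - x)} s \<le> (\<integral>\<^sup>+\<eta>. F s \<eta> \<partial>lborel)" for s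
  proof (cases "s \<in> {0..1} \<and> \<epsilon> < cmod (p s - x)")
    case True
    define r where "r = cmod (p s - x)"
    have r: "\<sigma> s = r" "\<epsilon> < r" "0 < r" using True \<epsilon> by (auto simp: r_def \<sigma>_def clamped_eq)
    \<comment> \<open>This keeps [r, 2 r] inside [\<epsilon>, 2 d].\<close>
    have rd: "r \<le> d"
      using diameter_bounded_bound[OF bounded_image p_in_image x, of s] True by (simp add: r_def d_def dist_norm)
    have "ennreal (\<omega> r / r\<^sup>2) = ennreal (\<omega> r / r ^ 3) * emeasure lborel {r..2 * r}"
      using r \<omega>(2)[of r] by (simp add: power2_eq_square power3_eq_cube flip: ennreal_mult')
    also have "\<dots> = (\<integral>\<^sup>+\<eta>. ennreal (\<omega> r / r ^ 3) * indicator {r..2 * r} \<eta> \<partial>lborel)"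
      by (simp add: nn_integral_cmult_indicator)
    also have "\<dots> \<le> (\<integral>\<^sup>+\<eta>. F s \<eta> \<partial>lborel)"
    proof (intro nn_integral_mono)
      fix \<eta>
      show "ennreal (\<omega> r / r ^ 3) * indicator {r..2 * r} \<eta> \<le> F s \<eta>"
      proof (cases "\<eta> \<in> {r..2 * r}")
        case \<eta>: True
        have "\<omega> r / r ^ 3 \<le> 4 / r * (\<omega> \<eta> / \<eta>\<^sup>2)"
        proof -
          have "\<eta>\<^sup>2 \<le> (2 * r)\<^sup>2" using \<eta> r by (intro power_mono) auto
          then have "\<omega> r / r\<^sup>2 \<le> \<omega> \<eta> / (\<eta>\<^sup>2 / 4)"
            using \<eta> r \<omega> by (intro frac_le monoD[OF \<omega>(1)]) auto
          then have "(\<omega> r / r\<^sup>2) / r \<le> (\<omega> \<eta> / (\<eta>\<^sup>2 / 4)) / r" using r by (intro divide_right_mono) auto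
          then show ?thesis by (simp add: power2_eq_square power3_eq_cube mult_ac)
        qed
        then have "ennreal (\<omega> r / r ^ 3) \<le> ennreal (4 / r * (\<omega> \<eta> / \<eta>\<^sup>2))" by (rule ennreal_leI)
        then show ?thesis using \<eta> True r rd by (simp add: F_def)
      qed auto
    qed
    finally show ?thesis using True by (simp add: r_def)
  qed auto
  \<comment> \<open>For fixed \<eta>, only curve points with \<eta> / 2 <= \<sigma> <= \<eta> count.
    There 4 / \<sigma> <= 8 / \<eta>, and their total arc length is at most K \<eta>, which gives 8
    K.\<close>
  have up: "(\<integral>\<^sup>+s. F s \<eta> \<partial>arc_measure) \<le> ennreal (8 * K) * (ennreal (\<omega> \<eta> / \<eta>\<^sup>2) * indicator {\<epsilon>..2 * d} \<eta>)" for \<eta>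
  proof (cases "\<eta> \<in> {\<epsilon>..2 * d}")
    case True
    then have \<eta>: "\<eta> > 0" using \<epsilon> by auto
    have "(\<integral>\<^sup>+s. F s \<eta> \<partial>arc_measure) \<le>
       (\<integral>\<^sup>+s. ennreal (8 / \<eta> * (\<omega> \<eta> / \<eta>\<^sup>2)) * indicator {s \<in> {0..1}. cmod (p s - x) \<le> \<eta>} s \<partial>arc_measure)"
    proof (intro nn_integral_mono)
      fix s
      show "F s \<eta> \<le> ennreal (8 / \<eta> * (\<omega> \<eta> / \<eta>\<^sup>2)) * indicator {s \<in> {0..1}. cmod (p s - x) \<le> \<eta>} s"
      proof (cases "s \<in> {0..1} \<and> \<epsilon> < \<sigma> s \<and> \<sigma> s \<le> \<eta> \<and> \<eta> \<le> 2 * \<sigma> s")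
        case s: True
        then have "4 / \<sigma> s \<le> 8 / \<eta>" using \<epsilon> \<eta> by (simp add: field_simps)
        then have "4 / \<sigma> s * (\<omega> \<eta> / \<eta>\<^sup>2) \<le> 8 / \<eta> * (\<omega> \<eta> / \<eta>\<^sup>2)"
          using \<omega>(2)[of \<eta>] by (intro mult_right_mono) auto
        then have "ennreal (4 / \<sigma> s * (\<omega> \<eta> / \<eta>\<^sup>2)) \<le> ennreal (8 / \<eta> * (\<omega> \<eta> / \<eta>\<^sup>2))" by (rule ennreal_leI)
        moreover have "cmod (p s - x) \<le> \<eta>" using s clamped_eq[of s] by (simp add: \<sigma>_def)
        ultimately show ?thesis using s True by (simp add: F_def)
      next
        case False
        then have "F s \<eta> = 0" by (auto simp: F_def)
        then show ?thesis by simp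
      qed
    qed
    also have "\<dots> = ennreal (8 / \<eta> * (\<omega> \<eta> / \<eta>\<^sup>2)) * emeasure arc_measure {s \<in> {0..1}. cmod (p s - x) \<le> \<eta>}"
      by (intro nn_integral_cmult_indicator) (simp only: sets_interval_measure sets_dist)
    also have "\<dots> \<le> ennreal (8 / \<eta> * (\<omega> \<eta> / \<eta>\<^sup>2)) * ennreal (K * \<eta>)"
      using x \<eta> by (intro mult_left_mono ahlfors) auto
    also have "\<dots> = ennreal (8 * K) * (ennreal (\<omega> \<eta> / \<eta>\<^sup>2))"
      using \<eta> K_pos \<omega>(2)[of \<eta>] by (simp flip: ennreal_mult')
    finally show ?thesis using True by simp
  next
    case False
    then have "F s \<eta> = 0" for s by (auto simp: F_def)
    then show ?thesis by simp
  qed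
  have "(\<integral>\<^sup>+s\<in>{s \<in> {0..1}. \<epsilon> < cmod (p s - x)}. ennreal (\<omega> (cmod (p s - x)) / (cmod (p s - x))\<^sup>2) \<partial>arc_measure)
      \<le> (\<integral>\<^sup>+s. \<integral>\<^sup>+\<eta>. F s \<eta> \<partial>lborel \<partial>arc_measure)" by (intro nn_integral_mono low)
  also have "\<dots> = (\<integral>\<^sup>+\<eta>. \<integral>\<^sup>+s. F s \<eta> \<partial>arc_measure \<partial>lborel)" by (rule Fubini'[OF F, symmetric])
  also have "\<dots> \<le> (\<integral>\<^sup>+\<eta>. ennreal (8 * K) * (ennreal (\<omega> \<eta> / \<eta>\<^sup>2) * indicator {\<epsilon>..2 * d} \<eta>) \<partial>lborel)"
    by (intro nn_integral_mono up)
  also have "\<dots> = ennreal (8 * K) * (\<integral>\<^sup>+\<eta>\<in>{\<epsilon>..2 * d}. ennreal (\<omega> \<eta> / \<eta>\<^sup>2) \<partial>lborel)"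
    by (intro nn_integral_cmult) measurable
  finally show ?thesis .
qed

end

text \<open>The asymptotic bound serves for radii below some b. From b on, the total length L is at
  most (L / b) \<epsilon>, so K = C + L / b works at all radii.\<close>

lemma ahlfors_regular_imp_ahlfors_curve:
  assumes "rectifiable_path p" "ahlfors_regular p"
  obtains K where "ahlfors_curve p K"
proof -
  interpret rectifiable_curve p by standard fact
  let ?S = "\<lambda>\<epsilon> x. {s \<in> {0..1}. cmod (p s - x) \<le> \<epsilon>}"
  have eq: "arc_length_measure p (curve_part p x \<epsilon>) = measure arc_measure (?S \<epsilon> x)" for x \<epsilon>
    unfolding arc_length_measure_def curve_part_def path_image_def
    by (rule arg_cong[where f = "measure arc_measure"]) auto
  obtain C where "C > 0" and
    "eventually (\<lambda>\<epsilon>. norm (SUP x \<in> path_image p. arc_length_measure p (curve_part p x \<epsilon>)) \<le> C * norm \<epsilon>) (at_right 0)"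
    using landau_o.bigE[OF assms(2)[unfolded ahlfors_regular_def]] by blast
  then obtain b where b: "b > 0" and
    C: "\<And>\<epsilon>. 0 < \<epsilon> \<Longrightarrow> \<epsilon> < b \<Longrightarrow> norm (SUP x \<in> path_image p. arc_length_measure p (curve_part p x \<epsilon>)) \<le> C * norm \<epsilon>"
    unfolding eventually_at_right_field by auto
  \<comment> \<open>L also bounds the family whose real \<open>SUP\<close> defines regularity; this
    boundedness puts each member below the supremum.\<close>
  define L where "L = measure arc_measure UNIV"
  have L: "measure arc_measure A \<le> L" for A unfolding L_def by (rule finite_measure_mono) auto
  have L0: "L \<ge> 0" by (simp add: L_def)
  define K where "K = C + L / b"
  have K: "K > 0" "C \<le> K" "L / b \<le> K" using \<open>C > 0\<close> b L0 by (auto simp: K_def add_pos_nonneg)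
  have "measure arc_measure (?S \<epsilon> x) \<le> K * \<epsilon>" if x: "x \<in> path_image p" and \<epsilon>: "0 < \<epsilon>" for x \<epsilon>
  proof (cases "\<epsilon> < b")
    case True
    have "measure arc_measure (?S \<epsilon> x) \<le> (SUP x \<in> path_image p. arc_length_measure p (curve_part p x \<epsilon>))"
      unfolding eq using L by (intro cSUP_upper2[OF _ x]) (auto intro!: bdd_aboveI[of _ L])
    also have "\<dots> \<le> C * \<epsilon>" using C[OF \<epsilon> True] \<epsilon> by simp
    also have "\<dots> \<le> K * \<epsilon>" using K \<epsilon> by (intro mult_right_mono) auto
    finally show ?thesis .
  next
    case False
    have "measure arc_measure (?S \<epsilon> x) \<le> L / b * b" using L b by simp
    also have "\<dots> \<le> K * \<epsilon>" using False b K L0 by (intro mult_mono) auto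
    finally show ?thesis .
  qed
  then have "ahlfors_curve p K"
    using K(1) by unfold_locales (auto simp: emeasure_eq_measure intro!: ennreal_leI)
  then show thesis by (rule that)
qed

section \<open>Cauchy kernels and the modulus of continuity\<close>

lemma ennreal_eight_mult: "0 \<le> x \<Longrightarrow> 0 \<le> y \<Longrightarrow> 8 * (ennreal x * ennreal y) = ennreal (8 * (x * y))"
  by (simp add: ennreal_mult')

lemma ennreal_affine:
  "0 \<le> x \<Longrightarrow> 0 \<le> y \<Longrightarrow> 0 \<le> z \<Longrightarrow> 0 \<le> w \<Longrightarrow>
    ennreal x * (ennreal y * ennreal z + ennreal w) = ennreal (x * (y * z + w))"
  by (simp add: ennreal_mult ennreal_plus)

context ahlfors_curve
begin

definition near_part :: "real \<Rightarrow> complex \<Rightarrow> real set" where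
  "near_part \<epsilon> x = {s \<in> {0..1}. cmod (p s - x) \<le> \<epsilon>}"

definition far_part :: "real \<Rightarrow> complex \<Rightarrow> real set" where
  "far_part \<epsilon> x = {s \<in> {0..1}. \<epsilon> < cmod (p s - x)}"

lemma sets_parts: "near_part \<epsilon> x \<in> sets borel" "far_part \<epsilon> x \<in> sets borel"
  unfolding near_part_def far_part_def by (rule sets_dist)+

lemma parts_subset: "near_part \<epsilon> x \<subseteq> {0..1}" "far_part \<epsilon> x \<subseteq> {0..1}"
  unfolding near_part_def far_part_def by auto

lemma parts: "{0..1} = near_part \<epsilon> x \<union> far_part \<epsilon> x" "near_part \<epsilon> x \<inter> far_part \<epsilon> x = {}"
  unfolding near_part_def far_part_def by auto

text \<open>1 / (p - w) is the conjugate of p - w over |p - w|^2. Replacing the denominator by its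
  maximum with m^2 changes nothing on S and gives a function continuous on all of [0, 1].\<close>

lemma admissible_cauchy_kernel:
  assumes g: "continuous_on (path_image p) g" and S: "S \<in> sets borel" "S \<subseteq> {0..1}"
    and m: "0 < m" "\<And>s. s \<in> S \<Longrightarrow> m \<le> cmod (p s - w)"
  shows "admissible S (\<lambda>s. complex_of_real (g (p s) - a) / (p s - w))"
proof -
  define h where "h s = complex_of_real (g (p s) - a) * (cnj (p s - w) / complex_of_real (max (m\<^sup>2) ((cmod (p s - w))\<^sup>2)))" for s
  have "continuous_on {0..1} (\<lambda>s. g (p s))"
    by (rule continuous_on_compose2[OF g continuous_p]) (auto simp: path_image_def)
  moreover have "max (m\<^sup>2) ((cmod (p s - w))\<^sup>2) \<noteq> 0" for s
    using m(1) by (metis max.strict_coboundedI1 order_less_irrefl zero_less_power)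
  ultimately have "continuous_on {0..1} h"
    unfolding h_def by (intro continuous_intros continuous_p) (auto simp flip: of_real_power)
  then have "admissible S h" by (rule admissible_continuous[OF _ S])
  moreover have "h s = complex_of_real (g (p s) - a) / (p s - w)" if "s \<in> S" for s
  proof -
    have "m\<^sup>2 \<le> (cmod (p s - w))\<^sup>2" using m that by (intro power_mono) auto
    then have "h s = complex_of_real (g (p s) - a) * (cnj (p s - w) / complex_of_real ((cmod (p s - w))\<^sup>2))"
      by (simp add: h_def max_absorb2)
    also have "\<dots> = complex_of_real (g (p s) - a) / (p s - w)"
    proof -
      have "p s - w \<noteq> 0" using m that by fastforce
      then show ?thesis by (subst complex_norm_square) simp
    qed
    finally show ?thesis .
  qed
  ultimately show ?thesis by (metis (no_types, lifting) admissible_cong)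
qed

lemma near_bound:
  assumes x: "x \<in> path_image p" and \<epsilon>: "0 < \<epsilon>" and f: "admissible (near_part \<epsilon> x) f"
    and b: "0 \<le> b" "\<And>s. s \<in> near_part \<epsilon> x \<Longrightarrow> cmod (f s) \<le> b"
  shows "cmod (parameter_integral p (near_part \<epsilon> x) f) \<le> 8 * K * \<epsilon> * b"
proof -
  have "ennreal (cmod (parameter_integral p (near_part \<epsilon> x) f)) \<le> 8 * (\<integral>\<^sup>+s\<in>near_part \<epsilon> x. ennreal (cmod (f s)) \<partial>arc_measure)"
    by (rule parameter_integral_bound[OF f])
  also have "\<dots> \<le> 8 * (\<integral>\<^sup>+s\<in>near_part \<epsilon> x. ennreal b \<partial>arc_measure)"
    by (intro mult_left_mono nn_integral_mono) (auto simp: indicator_def intro!: ennreal_leI b)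
  also have "(\<integral>\<^sup>+s\<in>near_part \<epsilon> x. ennreal b \<partial>arc_measure) = ennreal b * emeasure arc_measure (near_part \<epsilon> x)"
    by (rule nn_integral_cmult_indicator) (simp only: sets_interval_measure sets_parts)
  also have "\<dots> \<le> ennreal b * ennreal (K * \<epsilon>)"
    unfolding near_part_def by (intro mult_left_mono ahlfors x \<epsilon>) simp
  also have "8 * (ennreal b * ennreal (K * \<epsilon>)) = ennreal (8 * K * \<epsilon> * b)"
    using b(1) \<epsilon> K_pos by (simp add: ennreal_mult mult_ac)
  finally show ?thesis using b(1) \<epsilon> K_pos by (simp add: ennreal_le_iff mult_left_mono)
qed

end

section \<open>The modulus of continuity of g and the integral term of the bound\<close>

locale double_layer = ahlfors_curve +
  fixes g :: "complex \<Rightarrow> real"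
  assumes simple: "simple_path p" and closed_path: "pathfinish p = pathstart p"
    and winding_inside: "\<And>z. z \<in> inside (path_image p) \<Longrightarrow> winding_number p z = 1"
    and g_cont: "continuous_on (path_image p) g"
    and M_tendsto: "(M_curve p g \<longlongrightarrow> 0) (at_right 0)"
begin

abbreviation \<gamma> where "\<gamma> \<equiv> path_image p"

abbreviation d where "d \<equiv> diameter \<gamma>"

text \<open>Taken real for use in quotients; g is bounded on the compact curve, so
  \<open>modulus_eq\<close> shows that nothing infinite is lost.\<close>

definition \<omega> :: "real \<Rightarrow> real" where "\<omega> \<eta> = enn2real (modulus_of_continuity \<gamma> g \<eta>)"

text \<open>The second term of the right-hand side of the theorem, as
  \<open>integral_eq_\<Phi>\<close> confirms.\<close>

definition \<Phi> :: "real \<Rightarrow> ennreal" where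
  "\<Phi> \<epsilon> = ennreal \<epsilon> * (\<integral>\<^sup>+\<eta>\<in>{\<epsilon>..2 * d}. ennreal (\<omega> \<eta> / \<eta>\<^sup>2) \<partial>lborel)"

lemma modulus_eq: "modulus_of_continuity \<gamma> g \<eta> = ennreal (\<omega> \<eta>)"
proof -
  have "compact (g ` \<gamma>)"
    using g_cont compact_continuous_image[OF continuous_p]
    by (intro compact_continuous_image) (auto simp: path_image_def)
  then have "bounded (g ` \<gamma>)" by (rule compact_imp_bounded)
  then obtain B where B: "\<And>t. t \<in> \<gamma> \<Longrightarrow> \<bar>g t\<bar> \<le> B" by (auto simp: bounded_iff)
  have "modulus_of_continuity \<gamma> g \<eta> \<le> ennreal (2 * B)"
    unfolding modulus_of_continuity_def
  proof (intro SUP_least, clarify, intro ennreal_leI)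
    fix t1 t2 assume "t1 \<in> \<gamma>" "t2 \<in> \<gamma>"
    then show "dist (g t1) (g t2) \<le> 2 * B"
      using B[of t1] B[of t2] by (auto simp: dist_real_def)
  qed
  then have "modulus_of_continuity \<gamma> g \<eta> < top" by (auto simp: less_top[symmetric] top_unique)
  then show ?thesis by (simp add: \<omega>_def)
qed

lemma \<omega>_nonneg: "0 \<le> \<omega> \<eta>"
  by (simp add: \<omega>_def)

lemma \<omega>_mono: "mono \<omega>"
proof
  fix x y :: real assume "x \<le> y"
  then have "modulus_of_continuity \<gamma> g x \<le> modulus_of_continuity \<gamma> g y"
    unfolding modulus_of_continuity_def by (intro SUP_subset_mono) auto
  then show "\<omega> x \<le> \<omega> y" by (simp add: modulus_eq \<omega>_nonneg)
qed

lemma \<omega>_measurable[measurable]: "\<omega> \<in> borel_measurable borel"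
  by (rule borel_measurable_mono[OF \<omega>_mono])

lemma \<omega>_bound: "t1 \<in> \<gamma> \<Longrightarrow> t2 \<in> \<gamma> \<Longrightarrow> cmod (t1 - t2) \<le> \<eta> \<Longrightarrow> \<bar>g t1 - g t2\<bar> \<le> \<omega> \<eta>"
proof -
  assume "t1 \<in> \<gamma>" "t2 \<in> \<gamma>" "cmod (t1 - t2) \<le> \<eta>"
  then have "ennreal (dist (g t1) (g t2)) \<le> modulus_of_continuity \<gamma> g \<eta>"
    unfolding modulus_of_continuity_def by (intro SUP_upper2[of "(t1, t2)"]) (auto simp: dist_norm)
  then show ?thesis by (simp add: modulus_eq \<omega>_nonneg dist_real_def)
qed

text \<open>On [r, 2 r], which lies in [\<epsilon>, 2 d], the integrand is at least \<omega>(r) / (4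
  r^2), so \<epsilon> \<omega>(r) / (4 r) <= \<Phi>(\<epsilon>). This absorbs isolated values of
  \<omega> into the integral term.\<close>

lemma \<omega>_le:
  assumes "0 < \<epsilon>" "\<epsilon> \<le> r" "r \<le> d" "\<Phi> \<epsilon> \<le> ennreal B" "0 \<le> B"
  shows "\<omega> r \<le> 4 * (r / \<epsilon>) * B"
proof -
  have "ennreal (\<epsilon> * (\<omega> r / (4 * r))) = ennreal \<epsilon> * (ennreal (\<omega> r / (4 * r\<^sup>2)) * emeasure lborel {r..2 * r})"
    using assms \<omega>_nonneg[of r] by (simp add: power2_eq_square flip: ennreal_mult')
  also have "\<dots> = ennreal \<epsilon> * (\<integral>\<^sup>+\<eta>. ennreal (\<omega> r / (4 * r\<^sup>2)) * indicator {r..2 * r} \<eta> \<partial>lborel)"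
    by (simp add: nn_integral_cmult_indicator)
  also have "\<dots> \<le> \<Phi> \<epsilon>"
    unfolding \<Phi>_def
  proof (intro mult_left_mono nn_integral_mono)
    fix \<eta>
    show "ennreal (\<omega> r / (4 * r\<^sup>2)) * indicator {r..2 * r} \<eta> \<le> ennreal (\<omega> \<eta> / \<eta>\<^sup>2) * indicator {\<epsilon>..2 * d} \<eta>"
    proof (cases "\<eta> \<in> {r..2 * r}")
      case True
      have "\<eta>\<^sup>2 \<le> (2 * r)\<^sup>2" using True assms by (intro power_mono) auto
      then have "\<omega> r / (4 * r\<^sup>2) \<le> \<omega> \<eta> / \<eta>\<^sup>2"
        using True assms \<omega>_nonneg by (intro frac_le monoD[OF \<omega>_mono]) auto
      then show ?thesis using True assms by (simp add: ennreal_leI)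
    qed auto
  qed auto
  also note assms(4)
  finally have "\<epsilon> * (\<omega> r / (4 * r)) \<le> B" using assms(5) by (simp add: ennreal_le_iff)
  then show ?thesis using assms by (simp add: field_simps)
qed

text \<open>64 K is the 8 of \<open>parameter_integral_bound\<close> times the 8 K of
  \<open>far_integral\<close>.\<close>

lemma far_bound:
  assumes x: "x \<in> \<gamma>" and \<epsilon>: "0 < \<epsilon>" and f: "admissible (far_part \<epsilon> x) f" and a: "0 \<le> a"
    and le: "\<And>s. s \<in> far_part \<epsilon> x \<Longrightarrow> cmod (f s) \<le> a * \<epsilon> * (\<omega> (cmod (p s - x)) / (cmod (p s - x))\<^sup>2)"
    and B: "\<Phi> \<epsilon> \<le> ennreal B" "0 \<le> B"
  shows "cmod (parameter_integral p (far_part \<epsilon> x) f) \<le> 64 * K * a * B"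
proof -
  let ?I = "\<integral>\<^sup>+\<eta>\<in>{\<epsilon>..2 * d}. ennreal (\<omega> \<eta> / \<eta>\<^sup>2) \<partial>lborel"
  have m: "(\<lambda>s. ennreal (\<omega> (cmod (p s - x)) / (cmod (p s - x))\<^sup>2) * indicator (far_part \<epsilon> x) s) \<in> borel_measurable arc_measure"
  proof -
    have "(\<lambda>s. ennreal (\<omega> (cmod (p s - x)) / (cmod (p s - x))\<^sup>2) * indicator (far_part \<epsilon> x) s) =
      (\<lambda>s. ennreal (\<omega> (cmod (clamped s - x)) / (cmod (clamped s - x))\<^sup>2) * indicator (far_part \<epsilon> x) s)"
      by (rule ext) (auto simp: far_part_def clamped_eq indicator_def)
    moreover have [measurable]: "far_part \<epsilon> x \<in> sets borel" by (rule sets_parts)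
    ultimately show ?thesis by simp
  qed
  have "ennreal (cmod (parameter_integral p (far_part \<epsilon> x) f)) \<le> 8 * (\<integral>\<^sup>+s\<in>far_part \<epsilon> x. ennreal (cmod (f s)) \<partial>arc_measure)"
    by (rule parameter_integral_bound[OF f])
  also have "\<dots> \<le> 8 * (\<integral>\<^sup>+s. ennreal (a * \<epsilon>) * (ennreal (\<omega> (cmod (p s - x)) / (cmod (p s - x))\<^sup>2) * indicator (far_part \<epsilon> x) s) \<partial>arc_measure)"
  proof (intro mult_left_mono nn_integral_mono)
    fix s
    show "ennreal (cmod (f s)) * indicator (far_part \<epsilon> x) s
      \<le> ennreal (a * \<epsilon>) * (ennreal (\<omega> (cmod (p s - x)) / (cmod (p s - x))\<^sup>2) * indicator (far_part \<epsilon> x) s)"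
    proof (cases "s \<in> far_part \<epsilon> x")
      case True
      have "ennreal (cmod (f s)) \<le> ennreal (a * \<epsilon> * (\<omega> (cmod (p s - x)) / (cmod (p s - x))\<^sup>2))"
        by (rule ennreal_leI[OF le[OF True]])
      also have "\<dots> = ennreal (a * \<epsilon>) * ennreal (\<omega> (cmod (p s - x)) / (cmod (p s - x))\<^sup>2)"
        using a \<epsilon> by (intro ennreal_mult') simp
      finally show ?thesis using True by simp
    qed simp
  qed auto
  also have "\<dots> = 8 * (ennreal (a * \<epsilon>) * (\<integral>\<^sup>+s\<in>far_part \<epsilon> x. ennreal (\<omega> (cmod (p s - x)) / (cmod (p s - x))\<^sup>2) \<partial>arc_measure))"
    using m by (simp add: nn_integral_cmult)
  also have "\<dots> \<le> 8 * (ennreal (a * \<epsilon>) * (ennreal (8 * K) * ?I))"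
    unfolding far_part_def by (intro mult_left_mono far_integral[OF \<omega>_mono \<omega>_nonneg x \<epsilon>]) auto
  also have "\<dots> = ennreal (64 * K * a) * \<Phi> \<epsilon>"
  proof -
    have "8 * (ennreal (a * \<epsilon>) * ennreal (8 * K)) = ennreal (8 * ((a * \<epsilon>) * (8 * K)))"
      by (rule ennreal_eight_mult) (use a \<epsilon> K_pos in auto)
    also have "\<dots> = ennreal (64 * K * a) * ennreal \<epsilon>"
      using a \<epsilon> K_pos by (subst ennreal_mult'[symmetric]) (auto simp: mult_ac)
    finally show ?thesis by (simp add: \<Phi>_def mult.assoc[symmetric])
  qed
  also have "\<dots> \<le> ennreal (64 * K * a) * ennreal B" by (intro mult_left_mono B) auto
  also have "\<dots> = ennreal (64 * K * a * B)" using a K_pos by (simp add: ennreal_mult')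
  finally show ?thesis using a B K_pos by (subst (asm) ennreal_le_iff) auto
qed

text \<open>The new range [r, \<epsilon>] adds at most \<omega>(\<epsilon>) / r to the integral,
  thus \<omega>(\<epsilon>) <= 4 B after multiplication by r; the old range adds at most B.\<close>

lemma \<Phi>_mono:
  assumes "0 < r" "r \<le> \<epsilon>" "\<epsilon> \<le> d" "\<Phi> \<epsilon> \<le> ennreal B" "0 \<le> B"
  shows "\<Phi> r \<le> ennreal (5 * B)"
proof -
  let ?f = "\<lambda>\<eta>. ennreal (\<omega> \<eta> / \<eta>\<^sup>2)"
  have "(\<integral>\<^sup>+\<eta>\<in>{r..2 * d}. ?f \<eta> \<partial>lborel) \<le> (\<integral>\<^sup>+\<eta>. ennreal (\<omega> \<epsilon>) * (ennreal (1 / \<eta>\<^sup>2) * indicator {r..} \<eta>) + ?f \<eta> * indicator {\<epsilon>..2 * d} \<eta> \<partial>lborel)"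
  proof (intro nn_integral_mono)
    fix \<eta>
    show "?f \<eta> * indicator {r..2 * d} \<eta> \<le> ennreal (\<omega> \<epsilon>) * (ennreal (1 / \<eta>\<^sup>2) * indicator {r..} \<eta>) + ?f \<eta> * indicator {\<epsilon>..2 * d} \<eta>"
    proof (cases "\<eta> < \<epsilon>")
      case True
      then have "\<omega> \<eta> / \<eta>\<^sup>2 \<le> \<omega> \<epsilon> / \<eta>\<^sup>2" by (intro divide_right_mono monoD[OF \<omega>_mono]) auto
      then have "?f \<eta> \<le> ennreal (\<omega> \<epsilon>) * ennreal (1 / \<eta>\<^sup>2)"
        by (simp add: ennreal_leI \<omega>_nonneg flip: ennreal_mult')
      then show ?thesis using True by (auto simp: indicator_def)
    qed (auto simp: indicator_def)
  qed
  also have "\<dots> = ennreal (\<omega> \<epsilon>) * (\<integral>\<^sup>+\<eta>. ennreal (1 / \<eta>\<^sup>2) * indicator {r..} \<eta> \<partial>lborel) + (\<integral>\<^sup>+\<eta>\<in>{\<epsilon>..2 * d}. ?f \<eta> \<partial>lborel)"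
    by (simp add: nn_integral_add nn_integral_cmult)
  also have "(\<integral>\<^sup>+\<eta>. ennreal (1 / \<eta>\<^sup>2) * indicator {r..} \<eta> \<partial>lborel) = ennreal (0 - (- 1 / r))"
  proof (rule nn_integral_FTC_atLeast)
    show "((\<lambda>\<eta>::real. - 1 / \<eta>) \<longlongrightarrow> 0) at_top"
      by (intro tendsto_divide_0[OF tendsto_const] filterlim_at_top_imp_at_infinity filterlim_ident)
    show "DERIV (\<lambda>\<eta>. - 1 / \<eta>) x :> 1 / x\<^sup>2" if "r \<le> x" for x
      using that assms(1) by (auto intro!: derivative_eq_intros simp: power2_eq_square)
  qed auto
  finally have "\<Phi> r \<le> ennreal r * (ennreal (\<omega> \<epsilon>) * ennreal (1 / r) + (\<integral>\<^sup>+\<eta>\<in>{\<epsilon>..2 * d}. ?f \<eta> \<partial>lborel))"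
    unfolding \<Phi>_def by (intro mult_left_mono) auto
  also have "\<dots> = ennreal (\<omega> \<epsilon>) + ennreal r * (\<integral>\<^sup>+\<eta>\<in>{\<epsilon>..2 * d}. ?f \<eta> \<partial>lborel)"
    using assms \<omega>_nonneg by (simp add: distrib_left flip: ennreal_mult')
  also have "\<dots> \<le> ennreal (\<omega> \<epsilon>) + \<Phi> \<epsilon>"
    unfolding \<Phi>_def using assms by (intro add_left_mono mult_right_mono ennreal_leI) auto
  also have "\<dots> \<le> ennreal (4 * B) + ennreal B"
    using \<omega>_le[of \<epsilon> \<epsilon> B] assms by (intro add_mono ennreal_leI) auto
  finally show ?thesis using assms by (simp flip: ennreal_plus)
qed

text \<open>Split the integral at \<delta> with \<omega>(\<delta>) <= e / 2. Below \<delta> it is at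
  most (e / 2) / \<epsilon>, contributing e / 2; above \<delta> it is bounded independently of
  \<epsilon>, so the prefactor \<epsilon> makes it small.\<close>

lemma \<Phi>_tendsto: "(\<Phi> \<longlongrightarrow> 0) (at_right 0)"
proof -
  have d0: "d \<ge> 0" by (rule diameter_ge_0[OF bounded_image])
  have "eventually (\<lambda>\<epsilon>. \<Phi> \<epsilon> \<le> ennreal e) (at_right 0)" if e: "e > 0" for e
  proof -
    have "uniformly_continuous_on \<gamma> g"
      using g_cont compact_continuous_image[OF continuous_p]
      by (intro compact_uniformly_continuous) (auto simp: path_image_def)
    then obtain \<delta>' where \<delta>': "\<delta>' > 0" "\<And>x y. x \<in> \<gamma> \<Longrightarrow> y \<in> \<gamma> \<Longrightarrow> dist y x < \<delta>' \<Longrightarrow> dist (g y) (g x) < e / 2"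
      unfolding uniformly_continuous_on_def using e by (metis half_gt_zero)
    define \<delta> where "\<delta> = \<delta>' / 2"
    have \<delta>: "\<delta> > 0" using \<delta>' by (simp add: \<delta>_def)
    have "modulus_of_continuity \<gamma> g \<delta> \<le> ennreal (e / 2)"
      unfolding modulus_of_continuity_def
    proof (intro SUP_least, clarify, intro ennreal_leI)
      fix t1 t2 assume "t1 \<in> \<gamma>" "t2 \<in> \<gamma>" "dist t1 t2 \<le> \<delta>"
      then show "dist (g t1) (g t2) \<le> e / 2" using \<delta>'(2)[of t2 t1] \<delta>'(1) by (simp add: \<delta>_def)
    qed
    then have \<omega>\<delta>: "\<omega> \<delta> \<le> e / 2" using e by (simp add: modulus_eq)
    \<comment> \<open>The maximal integrand beyond \<delta> times the length of [0, 2 d].\<close>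
    define W where "W = \<omega> (2 * d) / \<delta>\<^sup>2 * (2 * d)"
    have W0: "W \<ge> 0" using \<omega>_nonneg d0 by (simp add: W_def)
    have "eventually (\<lambda>\<epsilon>::real. \<epsilon> < e / (2 * (W + 1))) (at_right 0)"
      using e W0 by (intro eventually_at_right_field[THEN iffD2] exI[of _ "e / (2 * (W + 1))"]) auto
    then show ?thesis
      using eventually_at_right_less[of 0]
    proof eventually_elim
      case (elim \<epsilon>)
      let ?f = "\<lambda>\<eta>. ennreal (\<omega> \<eta> / \<eta>\<^sup>2)"
      have "(\<integral>\<^sup>+\<eta>\<in>{\<epsilon>..2 * d}. ?f \<eta> \<partial>lborel) \<le> (\<integral>\<^sup>+\<eta>. ennreal (e / 2) * (ennreal (1 / \<eta>\<^sup>2) * indicator {\<epsilon>..} \<eta>) + ennreal (\<omega> (2 * d) / \<delta>\<^sup>2) * indicator {0..2 * d} \<eta> \<partial>lborel)"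
      proof (intro nn_integral_mono)
        fix \<eta>
        show "?f \<eta> * indicator {\<epsilon>..2 * d} \<eta> \<le> ennreal (e / 2) * (ennreal (1 / \<eta>\<^sup>2) * indicator {\<epsilon>..} \<eta>) + ennreal (\<omega> (2 * d) / \<delta>\<^sup>2) * indicator {0..2 * d} \<eta>"
        proof (cases "\<eta> \<le> \<delta>")
          case True
          then have "\<omega> \<eta> \<le> e / 2" using monoD[OF \<omega>_mono True] \<omega>\<delta> by simp
          then have "\<omega> \<eta> / \<eta>\<^sup>2 \<le> e / 2 / \<eta>\<^sup>2" by (intro divide_right_mono) auto
          then have "?f \<eta> \<le> ennreal (e / 2) * ennreal (1 / \<eta>\<^sup>2)"
            using e by (simp add: ennreal_leI flip: ennreal_mult')
          then show ?thesis by (auto simp: indicator_def intro: add_increasing2)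
        next
          case False
          show ?thesis
          proof (cases "\<eta> \<in> {\<epsilon>..2 * d}")
            case \<eta>: True
            have "\<delta>\<^sup>2 \<le> \<eta>\<^sup>2" using False \<delta> by (intro power_mono) auto
            then have "\<omega> \<eta> / \<eta>\<^sup>2 \<le> \<omega> (2 * d) / \<delta>\<^sup>2"
              using \<delta> \<eta> \<omega>_nonneg by (intro frac_le monoD[OF \<omega>_mono]) auto
            then show ?thesis using \<eta> elim by (auto simp: indicator_def intro: add_increasing ennreal_leI)
          qed auto
        qed
      qed
      also have "\<dots> = ennreal (e / 2) * (\<integral>\<^sup>+\<eta>. ennreal (1 / \<eta>\<^sup>2) * indicator {\<epsilon>..} \<eta> \<partial>lborel) + ennreal (\<omega> (2 * d) / \<delta>\<^sup>2) * emeasure lborel {0..2 * d}"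
        by (simp add: nn_integral_add nn_integral_cmult nn_integral_cmult_indicator)
      also have "(\<integral>\<^sup>+\<eta>. ennreal (1 / \<eta>\<^sup>2) * indicator {\<epsilon>..} \<eta> \<partial>lborel) = ennreal (0 - (- 1 / \<epsilon>))"
      proof (rule nn_integral_FTC_atLeast)
        show "((\<lambda>\<eta>::real. - 1 / \<eta>) \<longlongrightarrow> 0) at_top"
      by (intro tendsto_divide_0[OF tendsto_const] filterlim_at_top_imp_at_infinity filterlim_ident)
        show "DERIV (\<lambda>\<eta>. - 1 / \<eta>) x :> 1 / x\<^sup>2" if "\<epsilon> \<le> x" for x
          using that elim by (auto intro!: derivative_eq_intros simp: power2_eq_square)
      qed auto
      also have "ennreal (\<omega> (2 * d) / \<delta>\<^sup>2) * emeasure lborel {0..2 * d} = ennreal W"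
        using d0 \<omega>_nonneg by (simp add: W_def flip: ennreal_mult')
      finally have "\<Phi> \<epsilon> \<le> ennreal \<epsilon> * (ennreal (e / 2) * ennreal (0 - (- 1 / \<epsilon>)) + ennreal W)"
        unfolding \<Phi>_def by (intro mult_left_mono) auto
      also have "\<dots> = ennreal (\<epsilon> * (e / 2 * (1 / \<epsilon>) + W))"
        using ennreal_affine[of \<epsilon> "e / 2" "1 / \<epsilon>" W] elim e W0 by simp
      also have "\<dots> \<le> ennreal e"
      proof (rule ennreal_leI)
        have "\<epsilon> * W \<le> \<epsilon> * (W + 1)" using elim by simp
        also have "\<dots> \<le> e / (2 * (W + 1)) * (W + 1)" using elim W0 by (intro mult_right_mono) auto
        also have "\<dots> = e / 2" using W0 by (simp add: field_simps)
        finally show "\<epsilon> * (e / 2 * (1 / \<epsilon>) + W) \<le> e" using elim by (simp add: distrib_left)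
      qed
      finally show ?case .
    qed
  qed
  then have *: "eventually (\<lambda>\<epsilon>. \<Phi> \<epsilon> \<le> ennreal e) (at_right 0)" if "e > 0" for e using that by blast
  show ?thesis
  proof (rule order_tendstoI)
    fix a :: ennreal assume "0 < a"
    then obtain e where "e > 0" "ennreal e < a"
    proof -
      obtain b where b: "0 < b" "b < a" using dense[OF \<open>0 < a\<close>] by blast
      then show thesis by (cases b) (auto intro: that)
    qed
    then show "eventually (\<lambda>\<epsilon>. \<Phi> \<epsilon> < a) (at_right 0)" using *[of e] by (auto elim: eventually_mono)
  qed auto
qed

end

section \<open>Principal values and the double layer potential\<close>

lemma abs_Re_div_ii_le: "\<bar>Re (1 / \<i> * z)\<bar> \<le> cmod z"
  using abs_Re_le_cmod[of "1 / \<i> * z"] by (simp add: norm_mult norm_divide)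

context double_layer
begin

text \<open>The point \<xi> whose value is subtracted and the pole w are kept apart: they coincide
  in principal values, while in potentials w is off the curve.\<close>

definition kernel :: "complex \<Rightarrow> complex \<Rightarrow> real \<Rightarrow> complex" where
  "kernel \<xi> w s = complex_of_real (g (p s) - g \<xi>) / (p s - w)"

definition truncated :: "real \<Rightarrow> complex \<Rightarrow> real" where
  "truncated \<epsilon> \<xi> = Re (1 / \<i> * parameter_integral p (far_part \<epsilon> \<xi>) (kernel \<xi> \<xi>))"

definition layer :: "complex \<Rightarrow> complex \<Rightarrow> real" where
  "layer \<xi> w = Re (1 / \<i> * parameter_integral p {0..1} (kernel \<xi> w))"

text \<open>The limit is taken along the radii 1 / (n + 1), where \<open>truncated_tendsto\<close>
  gives convergence; \<open>principal_value_approx\<close> recovers the estimate for a general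
  radius.\<close>

definition principal_value :: "complex \<Rightarrow> real" where
  "principal_value \<xi> = lim (\<lambda>n. truncated (1 / real (Suc n)) \<xi>)"

lemma admissible_kernel:
  assumes "S \<in> sets borel" "S \<subseteq> {0..1}" "0 < m" "\<And>s. s \<in> S \<Longrightarrow> m \<le> cmod (p s - w)"
  shows "admissible S (kernel \<xi> w)"
  unfolding kernel_def by (rule admissible_cauchy_kernel[OF g_cont assms])

lemma admissible_kernel_far:
  "0 < \<epsilon> \<Longrightarrow> admissible (far_part \<epsilon> \<xi>) (kernel \<xi> \<xi>)"
  by (rule admissible_kernel[OF sets_parts(2) parts_subset(2)]) (auto simp: far_part_def)

lemma admissible_kernel_off:
  assumes "w \<notin> \<gamma>" "S \<in> sets borel" "S \<subseteq> {0..1}" shows "admissible S (kernel \<xi> w)"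
proof (rule admissible_kernel[OF assms(2,3)])
  show "0 < setdist {w} \<gamma>"
  proof -
    have "p 0 \<in> \<gamma>" by (rule p_in_image) simp
    then have "setdist {w} \<gamma> \<noteq> 0" using assms(1) setdist_eq_0_closed[OF closed_image, of w] by blast
    then show ?thesis using setdist_pos_le[of "{w}" \<gamma>] by linarith
  qed
  show "setdist {w} \<gamma> \<le> cmod (p s - w)" if "s \<in> S" for s
    using setdist_le_dist[of w "{w}" "p s" \<gamma>] p_in_image[of s] that assms(3) by (auto simp: dist_norm norm_minus_commute)
qed

text \<open>Turns the hypothesis on M into a Cauchy condition for truncated integrals as the radius
  shrinks.\<close>

lemma darg_integral_annulus:
  assumes "0 < \<delta>" "\<delta> < \<epsilon>"
  shows "darg_integral p \<xi> (curve_part p \<xi> \<epsilon> - curve_part p \<xi> \<delta>) (\<lambda>t. g t - g \<xi>) = truncated \<delta> \<xi> - truncated \<epsilon> \<xi>"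
proof -
  let ?N = "far_part \<delta> \<xi> \<inter> near_part \<epsilon> \<xi>"
  have N: "{s \<in> {0..1}. p s \<in> curve_part p \<xi> \<epsilon> - curve_part p \<xi> \<delta>} = ?N"
    by (auto simp: curve_part_def far_part_def near_part_def path_image_def)
  have U: "far_part \<delta> \<xi> = ?N \<union> far_part \<epsilon> \<xi>" "?N \<inter> far_part \<epsilon> \<xi> = {}"
    using assms by (auto simp: far_part_def near_part_def)
  have "parameter_integral p (far_part \<delta> \<xi>) (kernel \<xi> \<xi>) =
      parameter_integral p ?N (kernel \<xi> \<xi>) + parameter_integral p (far_part \<epsilon> \<xi>) (kernel \<xi> \<xi>)"
    by (subst U(1), rule parameter_integral_Un[OF _ _ U(2)])
       (use assms in \<open>auto intro!: admissible_subset[OF admissible_kernel_far[OF assms(1)]] admissible_kernel_far sets.Int sets_parts\<close>)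
  then show ?thesis
    unfolding darg_integral_def truncated_def curve_integral_eq N
    by (simp add: kernel_def[abs_def] o_def algebra_simps)
qed

lemma truncated_diff:
  assumes "\<xi> \<in> \<gamma>" "0 < \<delta>" "\<delta> < \<epsilon>" "M_curve p g \<epsilon> \<le> ennreal B" "0 \<le> B"
  shows "\<bar>truncated \<delta> \<xi> - truncated \<epsilon> \<xi>\<bar> \<le> B"
proof -
  have "ennreal \<bar>truncated \<delta> \<xi> - truncated \<epsilon> \<xi>\<bar> \<le> M_curve p g \<epsilon>"
    unfolding M_curve_def darg_integral_annulus[OF assms(2,3), symmetric]
    by (rule SUP_upper2[OF assms(1)], rule SUP_upper) (use assms in auto)
  also note assms(4)
  finally show ?thesis using assms(5) by simp
qed

text \<open>The truncations at \<delta> and at r each differ from the one at \<epsilon> by at most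
  B, hence from each other by at most 2 B.\<close>

lemma M_mono:
  assumes "0 < r" "r \<le> \<epsilon>" "M_curve p g \<epsilon> \<le> ennreal B" "0 \<le> B"
  shows "M_curve p g r \<le> ennreal (2 * B)"
proof (cases "r = \<epsilon>")
  case True
  then show ?thesis using assms order.trans[OF assms(3) ennreal_leI[of B "2 * B"]] by simp
next
  case False
  show ?thesis
    unfolding M_curve_def
  proof (intro SUP_least)
    fix \<xi> \<delta> assume *: "\<xi> \<in> \<gamma>" "\<delta> \<in> {0<..<r}"
    then have "\<bar>truncated \<delta> \<xi> - truncated r \<xi>\<bar> \<le> 2 * B"
      using truncated_diff[of \<xi> \<delta> \<epsilon> B] truncated_diff[of \<xi> r \<epsilon> B] assms False by auto
    then show "ennreal \<bar>darg_integral p \<xi> (curve_part p \<xi> r - curve_part p \<xi> \<delta>) (\<lambda>t. g t - g \<xi>)\<bar> \<le> ennreal (2 * B)"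
      using * by (simp add: darg_integral_annulus ennreal_leI)
  qed
qed

lemma truncated_tendsto:
  assumes "\<xi> \<in> \<gamma>"
  shows "(\<lambda>n. truncated (1 / real (Suc n)) \<xi>) \<longlonglongrightarrow> principal_value \<xi>"
proof -
  have "Cauchy (\<lambda>n. truncated (1 / real (Suc n)) \<xi>)"
  proof (rule metric_CauchyI)
    fix e :: real assume "e > 0"
    then have "eventually (\<lambda>\<epsilon>. M_curve p g \<epsilon> < ennreal (e / 3)) (at_right 0)"
      using order_tendstoD(2)[OF M_tendsto] by simp
    then obtain b where b: "b > 0" "\<And>\<epsilon>. 0 < \<epsilon> \<Longrightarrow> \<epsilon> < b \<Longrightarrow> M_curve p g \<epsilon> < ennreal (e / 3)"
      unfolding eventually_at_right_field by auto
    define r where "r = b / 2"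
    have r: "r > 0" "M_curve p g r \<le> ennreal (e / 3)" using b by (auto simp: r_def less_imp_le)
    obtain N where N: "1 / real (Suc N) < r" using nat_approx_posE[OF r(1)] by blast
    have "\<bar>truncated (1 / real (Suc n)) \<xi> - truncated r \<xi>\<bar> \<le> e / 3" if "n \<ge> N" for n
    proof (rule truncated_diff[OF assms _ _ r(2)])
      have "1 / real (Suc n) \<le> 1 / real (Suc N)" using that by (simp add: field_simps)
      then show "1 / real (Suc n) < r" using N by linarith
    qed (use \<open>e > 0\<close> in auto)
    note near = this
    have "dist (truncated (1 / real (Suc m)) \<xi>) (truncated (1 / real (Suc n)) \<xi>) < e" if "n \<ge> N" "m \<ge> N" for n m
      using near[OF that(1)] near[OF that(2)] \<open>e > 0\<close> unfolding dist_real_def by linarith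
    then show "\<exists>M. \<forall>m\<ge>M. \<forall>n\<ge>M. dist (truncated (1 / real (Suc m)) \<xi>) (truncated (1 / real (Suc n)) \<xi>) < e"
      by blast
  qed
  then show ?thesis unfolding principal_value_def by (intro convergent_LIMSEQ_iff[THEN iffD1] Cauchy_convergent)
qed

lemma principal_value_approx:
  assumes "\<xi> \<in> \<gamma>" "0 < \<epsilon>" "M_curve p g \<epsilon> \<le> ennreal B" "0 \<le> B"
  shows "\<bar>principal_value \<xi> - truncated \<epsilon> \<xi>\<bar> \<le> B"
proof (rule tendsto_upperbound)
  show "(\<lambda>n. \<bar>truncated (1 / real (Suc n)) \<xi> - truncated \<epsilon> \<xi>\<bar>) \<longlonglongrightarrow> \<bar>principal_value \<xi> - truncated \<epsilon> \<xi>\<bar>"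
    by (intro tendsto_intros truncated_tendsto assms)
  obtain N where N: "1 / real (Suc N) < \<epsilon>" using nat_approx_posE[OF assms(2)] by blast
  show "eventually (\<lambda>n. \<bar>truncated (1 / real (Suc n)) \<xi> - truncated \<epsilon> \<xi>\<bar> \<le> B) sequentially"
    using eventually_ge_at_top[of N]
  proof eventually_elim
    case (elim n)
    then have "1 / real (Suc n) \<le> 1 / real (Suc N)" by (simp add: field_simps)
    then have "1 / real (Suc n) < \<epsilon>" using N by linarith
    then show ?case by (intro truncated_diff assms) auto
  qed
qed auto

lemma kernel_diff:
  assumes "p s \<noteq> z" "p s \<noteq> w"
  shows "cmod (kernel \<xi> z s - kernel \<xi> w s) = \<bar>g (p s) - g \<xi>\<bar> * cmod (z - w) / (cmod (p s - z) * cmod (p s - w))"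
proof -
  have "kernel \<xi> z s - kernel \<xi> w s = complex_of_real (g (p s) - g \<xi>) * (z - w) / ((p s - z) * (p s - w))"
    using assms by (simp add: kernel_def field_simps)
  then show ?thesis by (simp add: norm_mult norm_divide del: of_real_diff)
qed

text \<open>Three errors add up. Truncating the principal value at \<epsilon> costs B. The near part
  of the potential costs 8 K \<epsilon> \<omega>(\<epsilon>) / (c \<epsilon>) <= (32 K / c) B, its
  pole being at distance c \<epsilon> from the curve. The difference of the kernels on the far part
  costs 64 K (128 / c) B. The last two give 32 + 8192 = 8224.\<close>

lemma principal_value_layer:
  assumes \<xi>: "\<xi> \<in> \<gamma>" and c: "0 < c" "c \<le> 1" and \<epsilon>: "0 < \<epsilon>" "\<epsilon> \<le> d"
    and w: "cmod (w - \<xi>) \<le> 8 * \<epsilon>" "\<And>t. t \<in> \<gamma> \<Longrightarrow> c * \<epsilon> \<le> cmod (t - w)"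
    and M: "M_curve p g \<epsilon> \<le> ennreal B" and Ph: "\<Phi> \<epsilon> \<le> ennreal B" and B: "0 \<le> B"
  shows "\<bar>principal_value \<xi> - layer \<xi> w\<bar> \<le> (1 + 8224 * K / c) * B"
proof -
  have "0 < c * \<epsilon>" using c \<epsilon> by simp
  have woff: "w \<notin> \<gamma>" using w(2)[of w] \<open>0 < c * \<epsilon>\<close> by auto
  let ?N = "near_part \<epsilon> \<xi>" and ?F = "far_part \<epsilon> \<xi>"
  have ad: "admissible ?N (kernel \<xi> w)" "admissible ?F (kernel \<xi> w)" "admissible ?F (kernel \<xi> \<xi>)"
    by (rule admissible_kernel_off[OF woff sets_parts(1) parts_subset(1)]
        admissible_kernel_off[OF woff sets_parts(2) parts_subset(2)] admissible_kernel_far[OF \<epsilon>(1)])+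
  have "parameter_integral p {0..1} (kernel \<xi> w) = parameter_integral p ?N (kernel \<xi> w) + parameter_integral p ?F (kernel \<xi> w)"
    by (subst parts(1)[of \<epsilon> \<xi>], rule parameter_integral_Un[OF ad(1,2) parts(2)])
  then have split: "truncated \<epsilon> \<xi> - layer \<xi> w =
      Re (1 / \<i> * parameter_integral p ?F (\<lambda>s. kernel \<xi> \<xi> s - kernel \<xi> w s)) - Re (1 / \<i> * parameter_integral p ?N (kernel \<xi> w))"
    unfolding truncated_def layer_def parameter_integral_diff[OF ad(3,2)] by (simp add: algebra_simps)
  have near: "cmod (parameter_integral p ?N (kernel \<xi> w)) \<le> 8 * K * \<epsilon> * (\<omega> \<epsilon> / (c * \<epsilon>))"
  proof (rule near_bound[OF \<xi> \<epsilon>(1) ad(1)])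
    show "0 \<le> \<omega> \<epsilon> / (c * \<epsilon>)" using \<omega>_nonneg c \<epsilon> by simp
    fix s assume "s \<in> ?N"
    then have s: "p s \<in> \<gamma>" "cmod (p s - \<xi>) \<le> \<epsilon>" using p_in_image by (auto simp: near_part_def)
    have "cmod (kernel \<xi> w s) = \<bar>g (p s) - g \<xi>\<bar> / cmod (p s - w)"
      by (simp add: kernel_def norm_divide del: of_real_diff)
    also have "\<dots> \<le> \<omega> \<epsilon> / (c * \<epsilon>)"
      using \<omega>_bound[OF s(1) \<xi> s(2)] w(2)[OF s(1)] \<open>0 < c * \<epsilon>\<close> by (intro frac_le) auto
    finally show "cmod (kernel \<xi> w s) \<le> \<omega> \<epsilon> / (c * \<epsilon>)" .
  qed
  also have "\<dots> = 8 * K / c * \<omega> \<epsilon>" using c \<epsilon> by (simp add: field_simps)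
  also have "\<dots> \<le> 8 * K / c * (4 * B)"
    using \<omega>_le[of \<epsilon> \<epsilon> B] \<epsilon> Ph B c K_pos by (intro mult_left_mono) auto
  finally have near: "cmod (parameter_integral p ?N (kernel \<xi> w)) \<le> 32 * K / c * B" by simp
  have far: "cmod (parameter_integral p ?F (\<lambda>s. kernel \<xi> \<xi> s - kernel \<xi> w s)) \<le> 64 * K * (128 / c) * B"
  proof (rule far_bound[OF \<xi> \<epsilon>(1) admissible_diff[OF ad(3,2)] _ _ Ph B])
    show "0 \<le> 128 / c" using c by simp
    fix s assume "s \<in> ?F"
    then have s: "p s \<in> \<gamma>" "\<epsilon> < cmod (p s - \<xi>)" using p_in_image by (auto simp: far_part_def)
    define \<sigma> where "\<sigma> = cmod (p s - \<xi>)"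
    have \<sigma>: "\<epsilon> < \<sigma>" "0 < \<sigma>" using s \<epsilon> by (auto simp: \<sigma>_def)
    \<comment> \<open>Far from \<xi>, at \<sigma> >= 16 \<epsilon>, the triangle inequality gives |p
      s - w| >= \<sigma> / 2; for smaller \<sigma> the distance c \<epsilon> of w from the curve is
      already at least c \<sigma> / 16.\<close>
    have low: "c * \<sigma> / 16 \<le> cmod (p s - w)"
    proof (cases "\<sigma> \<ge> 16 * \<epsilon>")
      case True
      have "\<sigma> - 8 * \<epsilon> \<le> cmod (p s - w)"
        using norm_triangle_ineq[of "p s - w" "w - \<xi>"] w(1) by (simp add: \<sigma>_def)
      moreover have "c * \<sigma> \<le> 1 * \<sigma>" using c \<sigma> by (intro mult_right_mono) auto
      ultimately show ?thesis using True \<sigma> by linarith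
    next
      case False
      then have "c * \<sigma> \<le> c * (16 * \<epsilon>)" using c by (intro mult_left_mono) auto
      then show ?thesis using w(2)[OF s(1)] by linarith
    qed
    have pos: "0 < c * \<sigma> / 16" using c \<sigma> by simp
    have "cmod (kernel \<xi> \<xi> s - kernel \<xi> w s) = \<bar>g (p s) - g \<xi>\<bar> * cmod (w - \<xi>) / (\<sigma> * cmod (p s - w))"
      using s \<epsilon> woff by (subst kernel_diff) (auto simp: \<sigma>_def norm_minus_commute)
    also have "\<dots> \<le> \<omega> \<sigma> * (8 * \<epsilon>) / (\<sigma> * (c * \<sigma> / 16))"
      using \<omega>_bound[OF s(1) \<xi>, of \<sigma>] low pos w(1) \<sigma> \<omega>_nonneg \<epsilon>
      by (intro frac_le mult_mono mult_left_mono mult_pos_pos) (auto simp: \<sigma>_def)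
    also have "\<dots> = 128 / c * \<epsilon> * (\<omega> \<sigma> / \<sigma>\<^sup>2)" by (simp add: power2_eq_square mult_ac)
    finally show "cmod (kernel \<xi> \<xi> s - kernel \<xi> w s) \<le> 128 / c * \<epsilon> * (\<omega> (cmod (p s - \<xi>)) / (cmod (p s - \<xi>))\<^sup>2)"
      by (simp add: \<sigma>_def)
  qed
  have "\<bar>truncated \<epsilon> \<xi> - layer \<xi> w\<bar> \<le> 64 * K * (128 / c) * B + 32 * K / c * B"
    unfolding split
    using abs_Re_div_ii_le[of "parameter_integral p ?F (\<lambda>s. kernel \<xi> \<xi> s - kernel \<xi> w s)"]
      abs_Re_div_ii_le[of "parameter_integral p ?N (kernel \<xi> w)"] near far by linarith
  moreover have "64 * K * (128 / c) * B + 32 * K / c * B = 8224 * K / c * B" by (simp add: field_simps)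
  ultimately show ?thesis
    using principal_value_approx[OF \<xi> \<epsilon>(1) M B] unfolding distrib_right mult_1_left by linarith
qed

section \<open>The winding index and the link to the Cauchy-type integral\<close>

definition index :: "complex \<Rightarrow> real" where
  "index z = (if z \<in> inside \<gamma> then 1 else 0)"

lemma winding_eq:
  assumes "z \<notin> \<gamma>" shows "winding_number p z = complex_of_real (index z)"
proof (cases "z \<in> inside \<gamma>")
  case True then show ?thesis using winding_inside by (simp add: index_def)
next
  case False
  have "z \<in> outside \<gamma>" using False assms inside_Un_outside[of \<gamma>] by blast
  then show ?thesis
    using winding_number_zero_in_outside[of p z] simple closed_path False
    by (simp add: index_def simple_path_imp_path)
qed

lemma argument_integral:
  assumes "w \<notin> \<gamma>"
  shows "parameter_integral p {0..1} (\<lambda>s. 1 / (p s - w)) = 2 * of_real pi * \<i> * complex_of_real (index w)"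
  using parameter_integral_winding[OF assms] winding_eq[OF assms] by simp

lemma admissible_inverse:
  assumes "w \<notin> \<gamma>" shows "admissible {0..1} (\<lambda>s. 1 / (p s - w))"
  by (rule admissible_continuous)
     (use assms continuous_p in \<open>auto intro!: continuous_intros simp: path_image_def\<close>)

text \<open>The two kernels differ by a constant multiple of 1 / (p - w), whose integral is the
  winding number up to 2 pi i.\<close>

lemma layer_shift:
  assumes "w \<notin> \<gamma>"
  shows "layer \<xi> w - layer \<xi>' w = 2 * pi * index w * (g \<xi>' - g \<xi>)"
proof -
  have ad: "admissible {0..1} (kernel \<xi> w)" "admissible {0..1} (kernel \<xi>' w)"
    by (auto intro!: admissible_kernel_off[OF assms])
  have eq: "(\<lambda>s. kernel \<xi> w s - kernel \<xi>' w s) = (\<lambda>s. complex_of_real (g \<xi>' - g \<xi>) * (1 / (p s - w)))"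
    by (auto simp: kernel_def diff_divide_distrib)
  have "parameter_integral p {0..1} (kernel \<xi> w) - parameter_integral p {0..1} (kernel \<xi>' w)
      = complex_of_real (g \<xi>' - g \<xi>) * (2 * of_real pi * \<i> * complex_of_real (index w))"
    unfolding parameter_integral_diff[OF ad, symmetric] eq parameter_integral_cmult argument_integral[OF assms] ..
  then have "1 / \<i> * (parameter_integral p {0..1} (kernel \<xi> w) - parameter_integral p {0..1} (kernel \<xi>' w))
      = complex_of_real (2 * pi * index w * (g \<xi>' - g \<xi>))"
    by (simp only:) (simp add: field_simps)
  then have "Re (1 / \<i> * (parameter_integral p {0..1} (kernel \<xi> w) - parameter_integral p {0..1} (kernel \<xi>' w)))
      = 2 * pi * index w * (g \<xi>' - g \<xi>)" by (simp only: Re_complex_of_real)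
  then show ?thesis unfolding layer_def right_diff_distrib[of "1 / \<i>"] minus_complex.simps .
qed

text \<open>The freedom in \<xi> is what matters: it can be the point of the curve nearest to w, or
  one point shared by two potentials.\<close>

lemma layer_cauchy:
  assumes "w \<notin> \<gamma>"
  shows "2 * pi * Re (cauchy_type_integral p g w) = layer \<xi> w + 2 * pi * index w * g \<xi>"
proof -
  have ad: "admissible {0..1} (kernel \<xi> w)" "admissible {0..1} (\<lambda>s. - complex_of_real (g \<xi>) * (1 / (p s - w)))"
    using admissible_mult[OF admissible_const admissible_inverse[OF assms], of "- complex_of_real (g \<xi>)"]
    by (auto intro!: admissible_kernel_off[OF assms])
  have S: "{s \<in> {0..1}. p s \<in> \<gamma>} = {0..1}" by (auto simp: path_image_def)
  have eq: "(\<lambda>s. kernel \<xi> w s - - complex_of_real (g \<xi>) * (1 / (p s - w))) = (\<lambda>t. complex_of_real (g t) / (t - w)) \<circ> p"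
    by (auto simp: kernel_def diff_divide_distrib)
  have "curve_integral p \<gamma> (\<lambda>t. complex_of_real (g t) / (t - w)) =
      parameter_integral p {0..1} (kernel \<xi> w) + complex_of_real (g \<xi>) * (2 * of_real pi * \<i> * complex_of_real (index w))"
    unfolding curve_integral_eq S eq[symmetric] parameter_integral_diff[OF ad]
    using parameter_integral_cmult[of "{0..1}" "- complex_of_real (g \<xi>)" "\<lambda>s. 1 / (p s - w)"] argument_integral[OF assms] by simp
  then have "complex_of_real (2 * pi) * cauchy_type_integral p g w =
      1 / \<i> * parameter_integral p {0..1} (kernel \<xi> w) + complex_of_real (2 * pi * index w * g \<xi>)"
    unfolding cauchy_type_integral_def by (simp add: field_simps)
  then have "Re (complex_of_real (2 * pi) * cauchy_type_integral p g w) =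
      Re (1 / \<i> * parameter_integral p {0..1} (kernel \<xi> w) + complex_of_real (2 * pi * index w * g \<xi>))" by (rule arg_cong)
  then show ?thesis unfolding layer_def by simp
qed

end

section \<open>Oscillation of the continuous extension\<close>

context double_layer
begin

text \<open>The comparison point \<open>w\<close> may lie on either side of the curve: moving the subtracted constant
  from \<open>g \<xi>1\<close> to \<open>g \<xi>2\<close> only costs the winding number of the curve about \<open>w\<close>.\<close>

lemma principal_value_osc:
  defines "c \<equiv> min (1/4) (1 / (16 * K))"
  assumes \<xi>: "\<xi>1 \<in> \<gamma>" "\<xi>2 \<in> \<gamma>" "cmod (\<xi>1 - \<xi>2) \<le> 6 * \<epsilon>" and \<epsilon>: "0 < \<epsilon>" "\<epsilon> \<le> d / 8"
    and M: "M_curve p g \<epsilon> \<le> ennreal B" and Ph: "\<Phi> \<epsilon> \<le> ennreal B" and B: "0 \<le> B"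
  shows "\<bar>principal_value \<xi>1 - principal_value \<xi>2\<bar> \<le> (2 * (1 + 8224 * K / c) + 192) * B"
proof -
  have c: "0 < c" "c \<le> 1" using K_pos by (auto simp: c_def)
  have \<epsilon>d: "\<epsilon> \<le> d" "\<epsilon> < d" using \<epsilon> by auto
  obtain w where w: "cmod (w - \<xi>1) \<le> \<epsilon>" "\<And>t. t \<in> \<gamma> \<Longrightarrow> c * \<epsilon> \<le> cmod (t - w)"
    using porosity[OF \<xi>(1) \<epsilon>(1) \<epsilon>d(2)] by (auto simp: c_def)
  have woff: "w \<notin> \<gamma>" using w(2)[of w] c \<epsilon> by (auto simp: mult_le_0_iff)
  have 1: "\<bar>principal_value \<xi>1 - layer \<xi>1 w\<bar> \<le> (1 + 8224 * K / c) * B"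
    by (rule principal_value_layer[OF \<xi>(1) c \<epsilon>(1) \<epsilon>d(1) _ w(2) M Ph B]) (use w(1) \<epsilon> in auto)
  \<comment> \<open>At most \<epsilon> + 6 \<epsilon>, within the 8 \<epsilon> allowed by
    \<open>principal_value_layer\<close>.\<close>
  have "cmod (w - \<xi>2) \<le> 8 * \<epsilon>"
    using norm_triangle_ineq[of "w - \<xi>1" "\<xi>1 - \<xi>2"] w(1) \<xi>(3) \<epsilon> by simp
  then have 2: "\<bar>principal_value \<xi>2 - layer \<xi>2 w\<bar> \<le> (1 + 8224 * K / c) * B"
    by (rule principal_value_layer[OF \<xi>(2) c \<epsilon>(1) \<epsilon>d(1) _ w(2) M Ph B])
  \<comment> \<open>6 \<epsilon> <= d, so \<omega>(6 \<epsilon>) <= 24 B; with 2 pi <= 8 the shift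
    of the subtracted constant costs 192 B.\<close>
  have "\<bar>g \<xi>2 - g \<xi>1\<bar> \<le> \<omega> (6 * \<epsilon>)" using \<omega>_bound[OF \<xi>] by (simp add: abs_minus_commute)
  also have "\<dots> \<le> 24 * B" using \<omega>_le[of \<epsilon> "6 * \<epsilon>" B] \<epsilon> Ph B by simp
  finally have "\<bar>g \<xi>2 - g \<xi>1\<bar> \<le> 24 * B" .
  moreover have "\<bar>2 * pi * index w\<bar> \<le> 8" using pi_less_4 pi_gt_zero by (simp add: index_def)
  ultimately have "\<bar>2 * pi * index w\<bar> * \<bar>g \<xi>2 - g \<xi>1\<bar> \<le> 8 * (24 * B)" by (intro mult_mono) auto
  then have 3: "\<bar>layer \<xi>1 w - layer \<xi>2 w\<bar> \<le> 192 * B" by (simp add: layer_shift[OF woff] abs_mult)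
  show ?thesis using 1 2 3 by (simp add: distrib_right)
qed

text \<open>The point z may be much closer to the curve than \<epsilon>, so the comparison runs at
  the scale r = min |\<xi> - z| \<epsilon>. There z has distance at least r from the curve, so c = 1
  is allowed, and distance at most 3 r from \<xi>. Both terms of the bound at r are at most 5
  B.\<close>

lemma boundary_estimate:
  assumes z: "z \<notin> \<gamma>" and \<xi>: "\<xi> \<in> \<gamma>" "\<And>t. t \<in> \<gamma> \<Longrightarrow> cmod (\<xi> - z) \<le> cmod (t - z)" "cmod (\<xi> - z) \<le> 3 * \<epsilon>"
    and \<epsilon>: "0 < \<epsilon>" "\<epsilon> \<le> d" and M: "M_curve p g \<epsilon> \<le> ennreal B" and Ph: "\<Phi> \<epsilon> \<le> ennreal B" and B: "0 \<le> B"
  shows "\<bar>2 * pi * Re (cauchy_type_integral p g z) - (2 * pi * index z * g \<xi> + principal_value \<xi>)\<bar> \<le> 5 * (1 + 8224 * K) * B"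
proof -
  define r where "r = min (cmod (\<xi> - z)) \<epsilon>"
  have r: "0 < r" "r \<le> \<epsilon>" "r \<le> d" using z \<xi>(1) \<epsilon> by (auto simp: r_def)
  have "M_curve p g r \<le> ennreal (2 * B)" by (rule M_mono[OF r(1,2) M B])
  also have "\<dots> \<le> ennreal (5 * B)" using B by (intro ennreal_leI) auto
  finally have Mr: "M_curve p g r \<le> ennreal (5 * B)" .
  have "\<bar>principal_value \<xi> - layer \<xi> z\<bar> \<le> (1 + 8224 * K / 1) * (5 * B)"
  proof (rule principal_value_layer[OF \<xi>(1) _ _ r(1,3) _ _ Mr \<Phi>_mono[OF r(1,2) \<epsilon>(2) Ph B]])
    show "cmod (z - \<xi>) \<le> 8 * r" using \<xi>(3) \<epsilon> by (auto simp: r_def min_def norm_minus_commute)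
    show "1 * r \<le> cmod (t - z)" if "t \<in> \<gamma>" for t using \<xi>(2)[OF that] by (simp add: r_def min.coboundedI1)
  qed (use B in auto)
  moreover have "(1 + 8224 * K / 1) * (5 * B) = 5 * (1 + 8224 * K) * B" by simp
  moreover have "2 * pi * Re (cauchy_type_integral p g z) - (2 * pi * index z * g \<xi> + principal_value \<xi>) = layer \<xi> z - principal_value \<xi>"
    by (simp add: layer_cauchy[OF z, of \<xi>])
  ultimately show ?thesis by (simp only: abs_minus_commute)
qed

text \<open>Away from the curve no principal value is needed: the potentials share \<xi>, and equal
  indices cancel the constant terms. The near part gives 8 K B, the far part 64 K * 8 B.\<close>

lemma interior_estimate:
  assumes z: "index z1 = index z2" "cmod (z1 - z2) \<le> \<epsilon>"
    and far: "\<And>t. t \<in> \<gamma> \<Longrightarrow> 2 * \<epsilon> \<le> cmod (t - z1)" "\<And>t. t \<in> \<gamma> \<Longrightarrow> 2 * \<epsilon> \<le> cmod (t - z2)"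
    and \<epsilon>: "0 < \<epsilon>" "\<epsilon> \<le> d" and Ph: "\<Phi> \<epsilon> \<le> ennreal B" and B: "0 \<le> B"
    and \<xi>: "\<xi> \<in> \<gamma>" "\<And>t. t \<in> \<gamma> \<Longrightarrow> cmod (\<xi> - z1) \<le> cmod (t - z1)"
  shows "\<bar>2 * pi * Re (cauchy_type_integral p g z1) - 2 * pi * Re (cauchy_type_integral p g z2)\<bar> \<le> 520 * K * B"
proof -
  have off: "z1 \<notin> \<gamma>" "z2 \<notin> \<gamma>" using far[of z1] far[of z2] \<epsilon> by auto
  let ?N = "near_part \<epsilon> \<xi>" and ?F = "far_part \<epsilon> \<xi>"
  let ?k = "\<lambda>s. kernel \<xi> z1 s - kernel \<xi> z2 s"
  have ad: "admissible {0..1} (kernel \<xi> z1)" "admissible {0..1} (kernel \<xi> z2)"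
    by (auto intro!: admissible_kernel_off off)
  have ad3: "admissible {0..1} ?k" by (rule admissible_diff[OF ad])
  have adk: "admissible ?N ?k" "admissible ?F ?k"
    by (rule admissible_subset[OF ad3 parts_subset(1) sets_parts(1)] admissible_subset[OF ad3 parts_subset(2) sets_parts(2)])+
  \<comment> \<open>As |z1 - z2| <= \<epsilon> is at most half the distance of z1 from any curve
    point, passing to z2 at most halves distances; since \<xi> is nearest to z1, distances from
    \<xi> are at most twice those from z1. The far denominators thus are at least \<sigma>^2 /
    8.\<close>
  have k: "cmod (?k s) = \<bar>g (p s) - g \<xi>\<bar> * cmod (z1 - z2) / (cmod (p s - z1) * cmod (p s - z2))"
    and half: "cmod (p s - z1) / 2 \<le> cmod (p s - z2)"
    and near: "cmod (p s - \<xi>) \<le> 2 * cmod (p s - z1)" if "p s \<in> \<gamma>" for s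
  proof -
    show "cmod (?k s) = \<bar>g (p s) - g \<xi>\<bar> * cmod (z1 - z2) / (cmod (p s - z1) * cmod (p s - z2))"
      by (rule kernel_diff) (use that off in auto)
    show "cmod (p s - z1) / 2 \<le> cmod (p s - z2)"
      using norm_triangle_ineq[of "p s - z2" "z2 - z1"] z(2) far(1)[OF that] by (simp add: norm_minus_commute)
    show "cmod (p s - \<xi>) \<le> 2 * cmod (p s - z1)"
      using norm_triangle_ineq4[of "p s - z1" "\<xi> - z1"] \<xi>(2)[OF that] by simp
  qed
  have "cmod (parameter_integral p ?N ?k) \<le> 8 * K * \<epsilon> * (\<omega> \<epsilon> * \<epsilon> / (2 * \<epsilon> * (2 * \<epsilon>)))"
  proof (rule near_bound[OF \<xi>(1) \<epsilon>(1) adk(1)])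
    show "0 \<le> \<omega> \<epsilon> * \<epsilon> / (2 * \<epsilon> * (2 * \<epsilon>))" using \<omega>_nonneg \<epsilon> by simp
    fix s assume "s \<in> ?N"
    then have s: "p s \<in> \<gamma>" "cmod (p s - \<xi>) \<le> \<epsilon>" using p_in_image by (auto simp: near_part_def)
    show "cmod (?k s) \<le> \<omega> \<epsilon> * \<epsilon> / (2 * \<epsilon> * (2 * \<epsilon>))"
      unfolding k[OF s(1)] using \<omega>_bound[OF s(1) \<xi>(1) s(2)] far[OF s(1)] z(2) \<epsilon> \<omega>_nonneg
      by (intro frac_le mult_mono mult_pos_pos) auto
  qed
  also have "\<dots> = 2 * K * \<omega> \<epsilon>" using \<epsilon> by (simp add: field_simps)
  also have "\<dots> \<le> 2 * K * (4 * B)"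
    using \<omega>_le[of \<epsilon> \<epsilon> B] \<epsilon> Ph B K_pos by (intro mult_left_mono) auto
  finally have nb: "cmod (parameter_integral p ?N ?k) \<le> 8 * K * B" by simp
  have fb: "cmod (parameter_integral p ?F ?k) \<le> 64 * K * 8 * B"
  proof (rule far_bound[OF \<xi>(1) \<epsilon>(1) adk(2) _ _ Ph B])
    fix s assume "s \<in> ?F"
    then have s: "p s \<in> \<gamma>" "\<epsilon> < cmod (p s - \<xi>)" using p_in_image by (auto simp: far_part_def)
    define \<sigma> where "\<sigma> = cmod (p s - \<xi>)"
    have \<sigma>: "0 < \<sigma>" "\<sigma> / 2 \<le> cmod (p s - z1)" "\<sigma> / 4 \<le> cmod (p s - z2)"
      using s \<epsilon> near[OF s(1)] half[OF s(1)] by (auto simp: \<sigma>_def)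
    have "cmod (?k s) \<le> \<omega> \<sigma> * \<epsilon> / (\<sigma> / 2 * (\<sigma> / 4))"
      unfolding k[OF s(1)] using \<omega>_bound[OF s(1) \<xi>(1), of \<sigma>] \<sigma> z(2) \<epsilon> \<omega>_nonneg
      by (intro frac_le mult_mono mult_pos_pos) (auto simp: \<sigma>_def)
    also have "\<dots> = 8 * \<epsilon> * (\<omega> \<sigma> / \<sigma>\<^sup>2)" by (simp add: power2_eq_square)
    finally show "cmod (?k s) \<le> 8 * \<epsilon> * (\<omega> (cmod (p s - \<xi>)) / (cmod (p s - \<xi>))\<^sup>2)" by (simp add: \<sigma>_def)
  qed simp
  have "parameter_integral p {0..1} (kernel \<xi> z1) - parameter_integral p {0..1} (kernel \<xi> z2) =
      parameter_integral p ?N ?k + parameter_integral p ?F ?k"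
    unfolding parameter_integral_diff[OF ad, symmetric]
    by (subst parts(1)[of \<epsilon> \<xi>], rule parameter_integral_Un[OF adk parts(2)])
  then have "layer \<xi> z1 - layer \<xi> z2 = Re (1 / \<i> * (parameter_integral p ?N ?k + parameter_integral p ?F ?k))"
    unfolding layer_def by (metis minus_complex.simps(1) right_diff_distrib)
  then have "\<bar>layer \<xi> z1 - layer \<xi> z2\<bar> \<le> cmod (parameter_integral p ?N ?k + parameter_integral p ?F ?k)"
    by (simp only: abs_Re_div_ii_le)
  also have "\<dots> \<le> 8 * K * B + 64 * K * 8 * B"
    using norm_triangle_ineq nb fb by (meson add_mono order.trans)
  finally have "\<bar>layer \<xi> z1 - layer \<xi> z2\<bar> \<le> 520 * K * B" by (simp add: mult_ac)
  then show ?thesis by (simp add: layer_cauchy[OF off(1), of \<xi>] layer_cauchy[OF off(2), of \<xi>] z(1))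
qed

text \<open>The boundary values are those of the Sokhotski-Plemelj formula. As g(\<xi>) is
  subtracted in the principal value, the jump term is n g(\<xi>), with n = 1 from the inside and n =
  0 from the outside.\<close>

definition extension :: "real \<Rightarrow> complex \<Rightarrow> real" where
  "extension n z = (if z \<in> \<gamma> then n * g z + principal_value z / (2 * pi) else Re (cauchy_type_integral p g z))"

text \<open>Either one point is within 2 \<epsilon> of the curve, and both are replaced by nearest
  boundary points, or both are far and \<open>interior_estimate\<close> applies. The constant
  collects two boundary replacements of 5 (1 + 8224 K), the comparison of principal values, 192 from
  its shift, 192 from the jump term n g, and 520 K from the interior case.\<close>

lemma extension_osc:
  defines "c \<equiv> min (1/4) (1 / (16 * K))"
  assumes D: "\<And>z. z \<in> D \<Longrightarrow> z \<notin> \<gamma> \<and> index z = n" and n: "\<bar>n\<bar> \<le> 1"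
    and z: "z1 \<in> D \<union> \<gamma>" "z2 \<in> D \<union> \<gamma>" "cmod (z1 - z2) \<le> \<epsilon>"
    and \<epsilon>: "0 < \<epsilon>" "\<epsilon> \<le> d / 8" and M: "M_curve p g \<epsilon> \<le> ennreal B" and Ph: "\<Phi> \<epsilon> \<le> ennreal B" and B: "0 \<le> B"
  shows "\<bar>extension n z1 - extension n z2\<bar> \<le> (10 * (1 + 8224 * K) + 2 * (1 + 8224 * K / c) + 384 + 520 * K) * B"
proof -
  have \<epsilon>d: "\<epsilon> \<le> d" using \<epsilon> by auto
  have c: "c > 0" using K_pos by (simp add: c_def)
  have nearest: "\<exists>\<xi>\<in>\<gamma>. \<forall>t\<in>\<gamma>. cmod (\<xi> - z) \<le> cmod (t - z)" for z
  proof -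
    have "\<gamma> \<noteq> {}" using p_in_image[of 0] by auto
    then obtain \<xi> where "\<xi> \<in> \<gamma>" "\<And>t. t \<in> \<gamma> \<Longrightarrow> dist z \<xi> \<le> dist z t"
      using distance_attains_inf[OF closed_image] by metis
    then show ?thesis by (auto simp: dist_norm norm_minus_commute)
  qed
  \<comment> \<open>On the curve the nearest point is z itself and the left-hand side vanishes by
    the definition of \<open>extension\<close>.\<close>
  have bd: "\<bar>2 * pi * extension n z - (2 * pi * n * g \<xi> + principal_value \<xi>)\<bar> \<le> 5 * (1 + 8224 * K) * B"
    if z: "z \<in> D \<union> \<gamma>" and \<xi>: "\<xi> \<in> \<gamma>" "\<And>t. t \<in> \<gamma> \<Longrightarrow> cmod (\<xi> - z) \<le> cmod (t - z)" "cmod (\<xi> - z) \<le> 3 * \<epsilon>" for z \<xi>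
  proof (cases "z \<in> \<gamma>")
    case True
    then have "\<xi> = z" using \<xi>(2)[of z] by simp
    then show ?thesis using True K_pos B by (simp add: extension_def field_simps)
  next
    case False
    then have "index z = n" using z D by auto
    then show ?thesis using boundary_estimate[OF False \<xi> \<epsilon>(1) \<epsilon>d M Ph B] False by (simp add: extension_def)
  qed
  \<comment> \<open>Stated for arbitrary points because it is used with either of the two as the one
    close to the curve. The distances 2 \<epsilon>, \<epsilon> and 3 \<epsilon> give |\<xi>1 -
    \<xi>2| <= 6 \<epsilon>.\<close>
  have close: "\<bar>2 * pi * extension n z1 - 2 * pi * extension n z2\<bar> \<le>
      (10 * (1 + 8224 * K) + 2 * (1 + 8224 * K / c) + 384) * B"
    if z: "z1 \<in> D \<union> \<gamma>" "z2 \<in> D \<union> \<gamma>" "cmod (z1 - z2) \<le> \<epsilon>"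
      and \<xi>: "\<xi>1 \<in> \<gamma>" "\<And>t. t \<in> \<gamma> \<Longrightarrow> cmod (\<xi>1 - z1) \<le> cmod (t - z1)" "cmod (\<xi>1 - z1) \<le> 2 * \<epsilon>" for z1 z2 \<xi>1
  proof -
    obtain \<xi>2 where \<xi>2: "\<xi>2 \<in> \<gamma>" "\<And>t. t \<in> \<gamma> \<Longrightarrow> cmod (\<xi>2 - z2) \<le> cmod (t - z2)" using nearest[of z2] by blast
    have r2: "cmod (\<xi>2 - z2) \<le> 3 * \<epsilon>"
      using \<xi>2(2)[OF \<xi>(1)] norm_triangle_ineq[of "\<xi>1 - z1" "z1 - z2"] \<xi>(3) z(3) by simp
    have "cmod (\<xi>1 - \<xi>2) \<le> cmod (\<xi>1 - z1) + cmod (z1 - z2) + cmod (\<xi>2 - z2)"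
      using norm_triangle_ineq[of "\<xi>1 - z1" "z1 - z2"] norm_triangle_ineq4[of "\<xi>1 - z2" "\<xi>2 - z2"] by simp
    then have \<xi>\<xi>: "cmod (\<xi>1 - \<xi>2) \<le> 6 * \<epsilon>" using r2 \<xi>(3) z(3) by simp
    have 1: "\<bar>2 * pi * extension n z1 - (2 * pi * n * g \<xi>1 + principal_value \<xi>1)\<bar> \<le> 5 * (1 + 8224 * K) * B"
      using \<xi> \<epsilon> by (intro bd z) auto
    have 2: "\<bar>2 * pi * extension n z2 - (2 * pi * n * g \<xi>2 + principal_value \<xi>2)\<bar> \<le> 5 * (1 + 8224 * K) * B"
      using \<xi>2 r2 by (intro bd z) auto
    have 3: "\<bar>principal_value \<xi>1 - principal_value \<xi>2\<bar> \<le> (2 * (1 + 8224 * K / c) + 192) * B"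
      unfolding c_def by (rule principal_value_osc[OF \<xi>(1) \<xi>2(1) \<xi>\<xi> \<epsilon> M Ph B])
    have "\<bar>g \<xi>1 - g \<xi>2\<bar> \<le> \<omega> (6 * \<epsilon>)" by (rule \<omega>_bound[OF \<xi>(1) \<xi>2(1) \<xi>\<xi>])
    also have "\<dots> \<le> 24 * B" using \<omega>_le[of \<epsilon> "6 * \<epsilon>" B] \<epsilon> Ph B by simp
    finally have "\<bar>g \<xi>1 - g \<xi>2\<bar> \<le> 24 * B" .
    moreover have "\<bar>2 * pi * n\<bar> \<le> 8"
      using mult_mono[of "2 * pi" 8 "\<bar>n\<bar>" 1] n pi_less_4 pi_gt_zero by (simp add: abs_mult)
    ultimately have "\<bar>2 * pi * n\<bar> * \<bar>g \<xi>1 - g \<xi>2\<bar> \<le> 8 * (24 * B)" by (intro mult_mono) auto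
    then have "\<bar>2 * pi * n * g \<xi>1 - 2 * pi * n * g \<xi>2\<bar> \<le> 192 * B"
      by (simp only: abs_mult[symmetric] right_diff_distrib)
    then show ?thesis using 1 2 3 unfolding distrib_right by linarith
  qed
  have KB: "0 \<le> K * B" "0 \<le> K / c * B" using K_pos B c by auto
  have *: "\<bar>2 * pi * extension n z1 - 2 * pi * extension n z2\<bar> \<le>
      (10 * (1 + 8224 * K) + 2 * (1 + 8224 * K / c) + 384 + 520 * K) * B"
  proof -
    obtain \<xi>1 where \<xi>1: "\<xi>1 \<in> \<gamma>" "\<And>t. t \<in> \<gamma> \<Longrightarrow> cmod (\<xi>1 - z1) \<le> cmod (t - z1)" using nearest[of z1] by blast
    obtain \<xi>2 where \<xi>2: "\<xi>2 \<in> \<gamma>" "\<And>t. t \<in> \<gamma> \<Longrightarrow> cmod (\<xi>2 - z2) \<le> cmod (t - z2)" using nearest[of z2] by blast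
    consider "cmod (\<xi>1 - z1) \<le> 2 * \<epsilon>" | "cmod (\<xi>2 - z2) \<le> 2 * \<epsilon>" |
      "2 * \<epsilon> \<le> cmod (\<xi>1 - z1)" "2 * \<epsilon> \<le> cmod (\<xi>2 - z2)" by linarith
    then show ?thesis
    proof cases
      case 1
      then show ?thesis using close[OF z \<xi>1] KB by (simp add: distrib_right)
    next
      case 2
      have "cmod (z2 - z1) \<le> \<epsilon>" using z(3) by (simp add: norm_minus_commute)
      from close[OF z(2,1) this \<xi>2 2] show ?thesis using KB by (simp add: distrib_right abs_minus_commute)
    next
      case 3
      have far: "2 * \<epsilon> \<le> cmod (t - z1)" "2 * \<epsilon> \<le> cmod (t - z2)" if "t \<in> \<gamma>" for t
        using 3 \<xi>1(2)[OF that] \<xi>2(2)[OF that] by linarith+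
      then have off: "z1 \<notin> \<gamma>" "z2 \<notin> \<gamma>" using \<epsilon> far[of z1] far[of z2] by auto
      then have "index z1 = index z2" using D z by auto
      from interior_estimate[OF this z(3) far \<epsilon>(1) \<epsilon>d Ph B \<xi>1] off
      have "\<bar>2 * pi * extension n z1 - 2 * pi * extension n z2\<bar> \<le> 520 * K * B" by (simp add: extension_def)
      moreover have "0 \<le> (10 * (1 + 8224 * K) + 2 * (1 + 8224 * K / c) + 384) * B"
        using K_pos c B by (intro mult_nonneg_nonneg add_nonneg_nonneg) auto
      ultimately show ?thesis unfolding distrib_right[of _ "520 * K"] by linarith
    qed
  qed
  have "\<bar>extension n z1 - extension n z2\<bar> * 1 \<le> \<bar>extension n z1 - extension n z2\<bar> * (2 * pi)"
    using pi_ge_two by (intro mult_left_mono) auto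
  also have "\<dots> = \<bar>2 * pi * extension n z1 - 2 * pi * extension n z2\<bar>"
  proof -
    have "2 * pi * extension n z1 - 2 * pi * extension n z2 = (extension n z1 - extension n z2) * (2 * pi)"
      by (simp add: algebra_simps)
    then show ?thesis by (simp add: abs_mult)
  qed
  finally show ?thesis using * by simp
qed

section \<open>Existence of the extension and the bound for every extension\<close>

lemma integral_eq_\<Phi>:
  assumes "0 < \<epsilon>"
  shows "ennreal \<epsilon> * (\<integral>\<^sup>+\<eta>\<in>{\<epsilon>..2 * d}. modulus_of_continuity \<gamma> g \<eta> / ennreal (\<eta>\<^sup>2) \<partial>lborel) = \<Phi> \<epsilon>"
  unfolding \<Phi>_def
proof (rule arg_cong2[where f = "(*)", OF refl nn_integral_cong])
  fix \<eta>
  show "modulus_of_continuity \<gamma> g \<eta> / ennreal (\<eta>\<^sup>2) * indicator {\<epsilon>..2 * d} \<eta> = ennreal (\<omega> \<eta> / \<eta>\<^sup>2) * indicator {\<epsilon>..2 * d} \<eta>"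
  proof (cases "\<eta> \<in> {\<epsilon>..2 * d}")
    case True
    then have "0 < \<eta>\<^sup>2" using assms by auto
    then show ?thesis by (simp add: modulus_eq divide_ennreal[OF \<omega>_nonneg])
  qed simp
qed

text \<open>M and \<Phi> both tend to 0, so for small \<epsilon> the oscillation bound holds with B
  = e / (2 C); this is uniform continuity on the closure, boundary points included.\<close>

lemma continuous_extension_exists:
  assumes D: "\<And>z. z \<in> D \<Longrightarrow> z \<notin> \<gamma> \<and> index z = n" "closure D \<subseteq> D \<union> \<gamma>" and n: "\<bar>n\<bar> \<le> 1" and d: "0 < d"
  shows "is_continuous_extension D (\<lambda>z. Re (cauchy_type_integral p g z)) (extension n)"
proof -
  define C where "C = 10 * (1 + 8224 * K) + 2 * (1 + 8224 * K / min (1/4) (1 / (16 * K))) + 384 + 520 * K"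
  have C: "C > 0" using K_pos by (simp add: C_def add_pos_pos)
  have "continuous_on (closure D) (extension n)"
  proof (rule uniformly_continuous_imp_continuous, unfold uniformly_continuous_on_def, intro allI impI)
    fix e :: real assume e: "e > 0"
    define B where "B = e / (2 * C)"
    have B: "B > 0" using e C by (simp add: B_def)
    have "eventually (\<lambda>\<epsilon>. M_curve p g \<epsilon> < ennreal B) (at_right 0)" "eventually (\<lambda>\<epsilon>. \<Phi> \<epsilon> < ennreal B) (at_right 0)"
      using order_tendstoD(2)[OF M_tendsto] order_tendstoD(2)[OF \<Phi>_tendsto] B by simp_all
    moreover have "eventually (\<lambda>\<epsilon>. \<epsilon> < d / 8 \<and> 0 < \<epsilon>) (at_right (0::real))"
      unfolding eventually_at_right_field using d by (intro exI[of _ "d / 8"]) auto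
    ultimately have "eventually (\<lambda>\<epsilon>. M_curve p g \<epsilon> < ennreal B \<and> \<Phi> \<epsilon> < ennreal B \<and> \<epsilon> < d / 8 \<and> 0 < \<epsilon>) (at_right 0)"
      by eventually_elim auto
    then obtain \<epsilon> where \<epsilon>: "M_curve p g \<epsilon> < ennreal B" "\<Phi> \<epsilon> < ennreal B" "\<epsilon> < d / 8" "0 < \<epsilon>"
      using eventually_happens'[OF trivial_limit_at_right_real] by blast
    have "dist (extension n z2) (extension n z1) < e"
      if "z1 \<in> closure D" "z2 \<in> closure D" "dist z2 z1 < \<epsilon>" for z1 z2
    proof -
      have "\<bar>extension n z2 - extension n z1\<bar> \<le> C * B"
        unfolding C_def by (rule extension_osc[where D = D and \<epsilon> = \<epsilon>]) (use that \<epsilon> D n B in \<open>auto simp: dist_norm less_imp_le\<close>)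
      also have "C * B < e" using C e by (simp add: B_def)
      finally show ?thesis by (simp add: dist_real_def)
    qed
    then show "\<exists>\<epsilon>>0. \<forall>x\<in>closure D. \<forall>x'\<in>closure D. dist x' x < \<epsilon> \<longrightarrow> dist (extension n x') (extension n x) < e"
      using \<epsilon>(4) by blast
  qed
  then show ?thesis using D by (auto simp: is_continuous_extension_def extension_def)
qed

text \<open>Any continuous extension agrees with \<open>extension n\<close> on D, hence on its
  closure, so the oscillation bound transfers to it.\<close>

lemma extension_modulus:
  assumes D: "\<And>z. z \<in> D \<Longrightarrow> z \<notin> \<gamma> \<and> index z = n" "closure D \<subseteq> D \<union> \<gamma>" and n: "\<bar>n\<bar> \<le> 1"
    and F: "is_continuous_extension D (\<lambda>z. Re (cauchy_type_integral p g z)) F" and \<epsilon>: "0 < \<epsilon>" "\<epsilon> \<le> d / 8"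
  shows "modulus_of_continuity (closure D) F \<epsilon> \<le>
    ennreal (10 * (1 + 8224 * K) + 2 * (1 + 8224 * K / min (1/4) (1 / (16 * K))) + 384 + 520 * K) * (M_curve p g \<epsilon> + \<Phi> \<epsilon>)"
proof -
  define C where "C = 10 * (1 + 8224 * K) + 2 * (1 + 8224 * K / min (1/4) (1 / (16 * K))) + 384 + 520 * K"
  have C: "C > 0" using K_pos by (simp add: C_def add_pos_pos)
  have "is_continuous_extension D (\<lambda>z. Re (cauchy_type_integral p g z)) (extension n)"
    using \<epsilon> by (intro continuous_extension_exists D n) auto
  then have "continuous_on (closure D) (\<lambda>z. F z - extension n z)" "\<And>z. z \<in> D \<Longrightarrow> F z - extension n z = 0"
    using F by (auto simp: is_continuous_extension_def intro!: continuous_on_diff)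
  then have "F z - extension n z = 0" if "z \<in> closure D" for z
    using continuous_constant_on_closure[of D "\<lambda>z. F z - extension n z" 0] that by blast
  then have F_eq: "F z = extension n z" if "z \<in> closure D" for z using that by simp
  \<comment> \<open>The value M + \<Phi> itself serves as B, as it bounds both terms; if it is
    infinite, so is the right-hand side.\<close>
  show ?thesis
  proof (cases "M_curve p g \<epsilon> + \<Phi> \<epsilon> < top")
    case False
    then have "M_curve p g \<epsilon> + \<Phi> \<epsilon> = top" by (simp only: less_top[symmetric] not_not)
    then have "ennreal C * (M_curve p g \<epsilon> + \<Phi> \<epsilon>) = top"
      using C by (simp only: ennreal_mult_top) simp
    then show ?thesis unfolding C_def by simp
  next
    case True
    then obtain B where B: "M_curve p g \<epsilon> + \<Phi> \<epsilon> = ennreal B" "0 \<le> B"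
      by (cases "M_curve p g \<epsilon> + \<Phi> \<epsilon>") auto
    have MP: "M_curve p g \<epsilon> \<le> ennreal B" "\<Phi> \<epsilon> \<le> ennreal B" unfolding B(1)[symmetric] by auto
    have "modulus_of_continuity (closure D) F \<epsilon> \<le> ennreal (C * B)"
      unfolding modulus_of_continuity_def
    proof (intro SUP_least, clarify, intro ennreal_leI)
      fix z1 z2 assume z: "z1 \<in> closure D" "z2 \<in> closure D" "dist z1 z2 \<le> \<epsilon>"
      show "dist (F z1) (F z2) \<le> C * B"
        unfolding dist_real_def F_eq[OF z(1)] F_eq[OF z(2)] C_def
        by (rule extension_osc[where D = D and \<epsilon> = \<epsilon>]) (use z D n \<epsilon> MP B in \<open>auto simp: dist_norm\<close>)
    qed
    then show ?thesis using C B by (simp add: ennreal_mult' C_def)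
  qed
qed

end

theorem theorem1:
  fixes p :: "real \<Rightarrow> complex" and \<gamma> :: "complex set" and d :: real
  assumes "rectifiable_jordan_curve p" and "ahlfors_regular p"
    and "\<gamma> = path_image p" and "d = diameter \<gamma>"
  shows "\<exists>c>0::real. \<forall>g :: complex \<Rightarrow> real.
    continuous_on \<gamma> g \<and> (M_curve p g \<longlongrightarrow> 0) (at_right 0) \<longrightarrow>
    (\<forall>D \<in> {inside \<gamma>, outside \<gamma>}.
       (\<exists>F. is_continuous_extension D (\<lambda>z. Re (cauchy_type_integral p g z)) F) \<and>
       (\<forall>F. is_continuous_extension D (\<lambda>z. Re (cauchy_type_integral p g z)) F \<longrightarrow>
         (\<forall>\<epsilon>\<in>{0<..d / 8}.
            modulus_of_continuity (closure D) F \<epsilon>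
              \<le> ennreal c * (M_curve p g \<epsilon> +
                   ennreal \<epsilon> * (\<integral>\<^sup>+\<eta>\<in>{\<epsilon>..2 * d}.
                      modulus_of_continuity \<gamma> g \<eta> / ennreal (\<eta>\<^sup>2) \<partial>lborel)))))"
proof -
  have p: "simple_path p" "pathfinish p = pathstart p" "rectifiable_path p"
      "\<And>z. z \<in> inside (path_image p) \<Longrightarrow> winding_number p z = 1"
    using assms(1) by (auto simp: rectifiable_jordan_curve_def)
  obtain K where "ahlfors_curve p K" using ahlfors_regular_imp_ahlfors_curve[OF p(3) assms(2)] .
  then interpret ahlfors_curve p K .
  \<comment> \<open>Positivity of the diameter guarantees admissible scales \<epsilon> <= d /
    8.\<close>
  have "0 < d"
  proof -
    have "p 0 \<noteq> p (1/2)"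
    proof
      assume *: "p 0 = p (1/2)"
      have "\<forall>x\<in>{0..1}. \<forall>y\<in>{0..1}. p x = p y \<longrightarrow> x = y \<or> x = 0 \<and> y = 1 \<or> x = 1 \<and> y = 0"
        using p(1) by (simp add: simple_path_def loop_free_def)
      from this[rule_format, of 0 "1/2"] * show False by simp
    qed
    then have "0 < dist (p 0) (p (1/2))" by simp
    also have "\<dots> \<le> d"
      unfolding assms(3,4) by (rule diameter_bounded_bound[OF bounded_image p_in_image p_in_image]) auto
    finally show ?thesis .
  qed
  \<comment> \<open>K is determined by the curve alone, so C is fixed before g.\<close>
  define C where "C = 10 * (1 + 8224 * K) + 2 * (1 + 8224 * K / min (1/4) (1 / (16 * K))) + 384 + 520 * K"
  have C: "C > 0" using K_pos by (simp add: C_def add_pos_pos)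
  have frontier: "frontier (inside \<gamma>) = \<gamma>" "frontier (outside \<gamma>) = \<gamma>"
    using Jordan_inside_outside[OF p(1,2)] assms(3) by auto
  have "(\<exists>F. is_continuous_extension D (\<lambda>z. Re (cauchy_type_integral p g z)) F) \<and>
       (\<forall>F. is_continuous_extension D (\<lambda>z. Re (cauchy_type_integral p g z)) F \<longrightarrow>
         (\<forall>\<epsilon>\<in>{0<..d / 8}.
            modulus_of_continuity (closure D) F \<epsilon>
              \<le> ennreal C * (M_curve p g \<epsilon> +
                   ennreal \<epsilon> * (\<integral>\<^sup>+\<eta>\<in>{\<epsilon>..2 * d}.
                      modulus_of_continuity \<gamma> g \<eta> / ennreal (\<eta>\<^sup>2) \<partial>lborel))))"
    if g: "continuous_on \<gamma> g" "(M_curve p g \<longlongrightarrow> 0) (at_right 0)" and D: "D \<in> {inside \<gamma>, outside \<gamma>}" for g D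
  proof -
    interpret double_layer p K g
      by unfold_locales (use p g assms(3) in auto)
    \<comment> \<open>The constant winding number of the curve about the points of D.\<close>
    define n :: real where "n = (if D = inside (path_image p) then 1 else 0)"
    have disj: "inside (path_image p) \<inter> path_image p = {}" "outside (path_image p) \<inter> path_image p = {}"
        "inside (path_image p) \<inter> outside (path_image p) = {}"
      by (simp_all add: inside_no_overlap outside_no_overlap inside_Int_outside)
    have D': "D = inside (path_image p) \<or> D = outside (path_image p)" using D assms(3) by blast
    have Dn: "z \<notin> path_image p \<and> index z = n" if "z \<in> D" for z
    proof (cases "D = inside (path_image p)")
      case True
      then have "z \<in> inside (path_image p)" using that by simp
      moreover from this have "z \<notin> path_image p" using disj(1) by blast
      ultimately show ?thesis using True by (simp add: index_def n_def)
    next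
      case False
      then have "z \<in> outside (path_image p)" using D' that by simp
      then have "z \<notin> inside (path_image p)" "z \<notin> path_image p" using disj by blast+
      then show ?thesis using False by (simp add: index_def n_def)
    qed
    \<comment> \<open>By the Jordan curve theorem the curve is the frontier of either
      component.\<close>
    have cl: "closure D \<subseteq> D \<union> path_image p"
    proof -
      have "frontier D = path_image p" using D' frontier unfolding assms(3) by metis
      then show ?thesis using closure_Un_frontier[of D] by simp
    qed
    have n: "\<bar>n\<bar> \<le> 1" by (simp add: n_def)
    have "\<exists>F. is_continuous_extension D (\<lambda>z. Re (cauchy_type_integral p g z)) F"
      using continuous_extension_exists[OF Dn cl n] \<open>0 < d\<close> unfolding assms(3,4) by blast
    moreover have "modulus_of_continuity (closure D) F \<epsilon> \<le> ennreal C * (M_curve p g \<epsilon> +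
        ennreal \<epsilon> * (\<integral>\<^sup>+\<eta>\<in>{\<epsilon>..2 * d}. modulus_of_continuity \<gamma> g \<eta> / ennreal (\<eta>\<^sup>2) \<partial>lborel))"
      if "is_continuous_extension D (\<lambda>z. Re (cauchy_type_integral p g z)) F" "\<epsilon> \<in> {0<..d / 8}" for F \<epsilon>
      using extension_modulus[OF Dn cl n that(1), of \<epsilon>] integral_eq_\<Phi>[of \<epsilon>] that(2)
      unfolding C_def assms(3,4) by simp
    ultimately show ?thesis by blast
  qed
  then show ?thesis using C by blast
qed

end
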